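(* Let $T<\infty$ be given. There exist constants $0<c_1,c_2,c_3<\infty$, with $c_1$ depending only on $T$ and $c_2,c_3$ universal, such that the following holds. Let $\gamma$ be a curve in $\mathbb{D}$ generating the radial Loewner pair $(f,W)$, and let $\eta_{\mathrm{tip}}(\delta)$ be the tip structure modulus of $(\gamma(t),\,t\in[0,T])$ in $\mathbb{D}$. If $t\in[0,T]$ and $\Delta_t(d)<c_1$, then $$|\gamma(t)-f_t((1-d)W_t)|\le c_2\,\eta_{\mathrm{tip}}\bigl(c_3\,\Delta_t(d)\bigr),$$ where $\Delta_t(d)=\operatorname{dist}\bigl(f_t((1-d)W_t),\partial D_t\bigr)$ and $D_t=f_t(\mathbb{D})$.
   Context: Radial Loewner pair $(f,W)$: $W:[0,\infty)\to\partial\mathbb{D}$ continuous, $W_t=W(t)$, and $f(t,z)=f_t(z)$ solves $\partial_t f_t(z)=-z f_t'(z)\frac{W_t+z}{W_t-z}$, $f_0(z)=z$, $z\in\mathbb{D}$. Each $f_t$ maps $\mathbb{D}$ conformally onto a simply connected domain $D_t\subset\mathbb{D}$ containing $0$. The pair is generated by a curve $\gamma$ if $\gamma$ is continuous, $\gamma(t)=\lim_{d\to0+}f_t((1-d)W_t)$, and $D_t$ is the connected component of $\mathbb{D}\setminus\gamma[0,t]$ containing $0$. A crosscut $\mathcal{C}$ of a simply connected domain $G$ is an open Jordan arc in $G$ with $\overline{\mathcal{C}}=\mathcal{C}\cup\{\zeta,\eta\}$, $\zeta,\eta\in\partial G$. Tip structure modulus of $(\gamma(t),t\in[0,T])$ in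 $\mathbb{D}$: for $t\in[0,T]$, $\delta>0$ let $S_{t,\delta}$ be the collection of crosscuts of $D_t$ of diameter at most $\delta$ that separate $\gamma(t)$ from $0$ in $D_t$. For $\mathcal{C}\in S_{t,\delta}$ let $s_{\mathcal{C}}=\inf\{s>0:\gamma[t-s,t]\cap\overline{\mathcal{C}}\ne\varnothing\}$ (with $s_{\mathcal{C}}=t$ if $\gamma[0,t]$ never intersects $\overline{\mathcal{C}}$) and let $\gamma_{\mathcal{C}}=(\gamma(r),\,r\in[t-s_{\mathcal{C}},t])$. Then $$\eta_{\mathrm{tip}}(\delta)=\max\Bigl\{\delta,\ \sup_{t\in[0,T]}\sup_{\mathcal{C}\in S_{t,\delta}}\operatorname{diam}\gamma_{\mathcal{C}}\Bigr\}.$$ *)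

theory Defs
  imports "HOL-Complex_Analysis.Complex_Analysis"
begin

definition radial_loewner_pair :: "(real \<Rightarrow> complex \<Rightarrow> complex) \<Rightarrow> (real \<Rightarrow> complex) \<Rightarrow> bool" where
  "radial_loewner_pair f W \<longleftrightarrow>
     continuous_on {0..} W \<and> W ` {0..} \<subseteq> sphere 0 1 \<and>
     (\<forall>z\<in>ball 0 1. f 0 z = z) \<and>
     (\<forall>t\<ge>0. \<forall>z\<in>ball 0 1.
        ((\<lambda>s. f s z) has_vector_derivative
           (- z * deriv (f t) z * ((W t + z) / (W t - z)))) (at t within {0..})) \<and>
     (\<forall>t\<ge>0. f t holomorphic_on ball 0 1 \<and> inj_on (f t) (ball 0 1) \<and>
        simply_connected (f t ` ball 0 1) \<and> f t ` ball 0 1 \<subseteq> ball 0 1 \<and> 0 \<in> f t ` ball 0 1)"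

definition loewner_domain :: "(real \<Rightarrow> complex \<Rightarrow> complex) \<Rightarrow> real \<Rightarrow> complex set" where
  "loewner_domain f t = f t ` ball 0 1"

definition radial_point ::
    "(real \<Rightarrow> complex \<Rightarrow> complex) \<Rightarrow> (real \<Rightarrow> complex) \<Rightarrow> real \<Rightarrow> real \<Rightarrow> complex" where
  "radial_point f W t d = f t (complex_of_real (1 - d) * W t)"

text \<open>The curve takes values in the closed unit disc, by the limit condition; it may touch
  the unit circle (and starts there).\<close>

definition generated_by_curve ::
    "(real \<Rightarrow> complex \<Rightarrow> complex) \<Rightarrow> (real \<Rightarrow> complex) \<Rightarrow> (real \<Rightarrow> complex) \<Rightarrow> bool" where
  "generated_by_curve f W \<gamma> \<longleftrightarrow>
     continuous_on {0..} \<gamma> \<and>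
     (\<forall>t\<ge>0. (radial_point f W t \<longlongrightarrow> \<gamma> t) (at_right 0)) \<and>
     (\<forall>t\<ge>0. loewner_domain f t = connected_component_set (ball 0 1 - \<gamma> ` {0..t}) 0)"

text \<open>The two end points of a crosscut may coincide.\<close>

definition crosscut :: "complex set \<Rightarrow> complex set \<Rightarrow> bool" where
  "crosscut G C \<longleftrightarrow>
     C \<subseteq> G \<and> C homeomorphic {0<..<1::real} \<and>
     (\<exists>\<zeta>\<in>frontier G. \<exists>\<xi>\<in>frontier G. closure C = C \<union> {\<zeta>, \<xi>})"

text \<open>The tip \<open>\<gamma> t\<close> is a boundary point of the domain and may be a multiple one (when the curve
  touches its past or the circle).  It is therefore understood as the boundary point approached
  along \<open>f t ((1 - d) * W t)\<close> as \<open>d\<close> decreases to \<open>0\<close>, the limit defining \<open>\<gamma> t\<close>: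
  a set \<open>C\<close> separates the tip from \<open>0\<close> if this path finally stays in components of the
  domain minus \<open>C\<close> other than that of \<open>0\<close>.\<close>

definition separates_tip ::
    "(real \<Rightarrow> complex \<Rightarrow> complex) \<Rightarrow> (real \<Rightarrow> complex) \<Rightarrow> real \<Rightarrow> complex set \<Rightarrow> bool" where
  "separates_tip f W t C \<longleftrightarrow>
     0 \<notin> C \<and>
     (\<forall>\<^sub>F d in at_right 0. radial_point f W t d \<notin> C \<and>
        \<not> connected_component (loewner_domain f t - C) 0 (radial_point f W t d))"

definition tip_crosscuts ::
    "(real \<Rightarrow> complex \<Rightarrow> complex) \<Rightarrow> (real \<Rightarrow> complex) \<Rightarrow> real \<Rightarrow> real \<Rightarrow> complex set set" where
  "tip_crosscuts f W t \<delta> =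
     {C. crosscut (loewner_domain f t) C \<and> diameter C \<le> \<delta> \<and> separates_tip f W t C}"

text \<open>The bound \<open>s \<le> t\<close> keeps \<open>{t - s..t}\<close> within the time domain of the curve.\<close>

definition crosscut_time :: "(real \<Rightarrow> complex) \<Rightarrow> real \<Rightarrow> complex set \<Rightarrow> real" where
  "crosscut_time \<gamma> t C =
     (let S = {s. 0 < s \<and> s \<le> t \<and> \<gamma> ` {t - s..t} \<inter> closure C \<noteq> {}}
      in if S = {} then t else Inf S)"

definition crosscut_subpath :: "(real \<Rightarrow> complex) \<Rightarrow> real \<Rightarrow> complex set \<Rightarrow> complex set" where
  "crosscut_subpath \<gamma> t C = \<gamma> ` {t - crosscut_time \<gamma> t C..t}"

text \<open>Extended reals give the supremum of an empty family the neutral value for \<open>max\<close>.\<close>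

definition tip_structure_modulus ::
    "(real \<Rightarrow> complex \<Rightarrow> complex) \<Rightarrow> (real \<Rightarrow> complex) \<Rightarrow> (real \<Rightarrow> complex) \<Rightarrow> real \<Rightarrow> real \<Rightarrow> ereal"
  where
  "tip_structure_modulus f W \<gamma> T \<delta> =
     max (ereal \<delta>)
       (SUP t\<in>{0..T}. SUP C\<in>tip_crosscuts f W t \<delta>. ereal (diameter (crosscut_subpath \<gamma> t C)))"

definition boundary_dist ::
    "(real \<Rightarrow> complex \<Rightarrow> complex) \<Rightarrow> (real \<Rightarrow> complex) \<Rightarrow> real \<Rightarrow> real \<Rightarrow> real" where
  "boundary_dist f W t d = infdist (radial_point f W t d) (frontier (loewner_domain f t))"

end

theory Submission imports Defs begin

text \<open>Write \<open>z\<close> for the point \<open>f\<^sub>t((1 - d) W\<^sub>t)\<close>, \<open>\<Delta>\<close> for its distance to the boundary of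
\<open>D\<^sub>t\<close>, and \<open>r = 150 \<Delta>\<close>.  The crosscut that the tip structure modulus has to see is an arc of the
circle of radius \<open>r\<close> about \<open>z\<close>: its diameter is at most \<open>300 \<Delta>\<close>, and it is within \<open>r\<close>
of \<open>z\<close>, so only the separation of the tip from \<open>0\<close> has to be proved.

If \<open>\<Delta>\<close> is small compared with the inner radius of \<open>D\<^sub>t\<close> at \<open>0\<close>, then \<open>0\<close> is outside the
circle.  The inner radius is bounded below in terms of \<open>T\<close> alone, because the Loewner equation gives
\<open>f\<^sub>t'(0) = exp(- t)\<close> (\<open>loewner_deriv_zero\<close>, \<open>loewner_domain_inner_radius\<close>); this is where
\<open>c\<^sub>1\<close> comes from.  As \<open>D\<^sub>t\<close> is homeomorphic to the plane, one component \<open>A\<close> of the circle in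
\<open>D\<^sub>t\<close> already separates \<open>z\<close> from \<open>0\<close> (\<open>component_separates_plane_domain\<close>), and such a component
is a crosscut (\<open>circle_component_crosscut\<close>).

The path \<open>x \<mapsto> f\<^sub>t(x W\<^sub>t)\<close> runs from \<open>0\<close> across \<open>A\<close> to \<open>z\<close> and on to the tip.  It never
meets \<open>A\<close> after \<open>z\<close>, so that \<open>A\<close> separates the tip from \<open>0\<close> as well.  Otherwise an arc of \<open>A\<close> would
join two points of the path on either side of \<open>z\<close>.  Send the preimage of \<open>z\<close> to the centre of
the disc by an automorphism, so that \<open>f\<^sub>t\<close> becomes \<open>g\<close> with \<open>g(0) = z\<close> and the arc becomes
a path \<open>p\<close> from the negative to the positive real axis.  With a boundary point \<open>w\<close> nearest to \<open>z\<close>,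
let \<open>m = 1 / (1 + \<surd>((g - w) / (z - w)))\<close>.  This is bounded by an absolute constant, since a square
root of an injective function never takes both a nonzero value and its negative; it is \<open>1/2\<close> at the
centre, and it is small on \<open>p\<close>, where \<open>|g - z| = 150 \<Delta>\<close>.  But \<open>p\<close> and its complex conjugate
surround \<open>0\<close>, so the maximum principle for \<open>m(\<zeta>) cnj(m(cnj \<zeta>))\<close> yields a contradiction
(\<open>symmetrized_maximum_principle\<close>, \<open>no_far_path_across_center\<close>).

Finally, if the curve up to time \<open>t\<close> hits the closure of \<open>A\<close>, then the part of the curve since the last
hit joins the tip to a point at distance \<open>r\<close> from \<open>z\<close>, and its diameter is at most the modulus.
If there is no hit, then both ends of \<open>A\<close> are on the unit circle; unicoherence of the disc shows that
\<open>A\<close> separates the tip from \<open>0\<close> in the whole disc, where the tip is therefore enclosed by the circle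
(\<open>crosscut_off_curve_encloses_tip\<close>).\<close>

section \<open>A reflected maximum principle\<close>

text \<open>The argument of \<open>p\<close> changes by an odd multiple of \<open>\<pi>\<close>.  Running along \<open>p\<close> and back along its
mirror image doubles this change, so the resulting loop has an odd winding number about \<open>0\<close>.\<close>

lemma zero_inside_symmetrized_path:
  fixes p :: "real \<Rightarrow> complex"
  assumes p: "path p" "0 \<notin> path_image p"
    and ends: "pathstart p = of_real a" "pathfinish p = of_real b" "a < 0" "0 < b"
  shows "0 \<in> inside (path_image p \<union> cnj ` path_image p)"
proof (rule ccontr)
  define q where "q = reversepath (cnj \<circ> p)"
  define n where "n = winding_number p 0"
  have cp: "path (cnj \<circ> p)" "path_image (cnj \<circ> p) = cnj ` path_image p"
    using p by (auto simp: path_def path_image_def image_comp intro!: continuous_intros continuous_on_compose)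
  have 0: "0 \<notin> cnj ` path_image p"
    using p by auto
  have q: "path q" "path_image q = cnj ` path_image p" "0 \<notin> path_image q"
    "pathstart q = of_real b" "pathfinish q = of_real a"
    using cp 0 ends unfolding q_def path_image_reversepath
    by (auto simp: pathstart_compose pathfinish_compose)
  have "winding_number (cnj \<circ> p) 0 = - cnj n"
    using winding_number_cnj[OF p] by (simp add: n_def)
  then have "winding_number q 0 = cnj n"
    using winding_number_reversepath[of "cnj \<circ> p" 0] cp 0 by (simp add: q_def)
  then have wn: "winding_number (p +++ q) 0 = n + cnj n"
    using winding_number_join[of p 0 q] p q ends by (simp add: n_def)
  have im: "path_image (p +++ q) = path_image p \<union> cnj ` path_image p"
    using q ends by (simp add: path_image_join)
  assume "\<not> ?thesis"
  then have "0 \<in> outside (path_image (p +++ q))"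
    using inside_Un_outside[of "path_image p \<union> cnj ` path_image p"] p(2) 0 unfolding im by blast
  then have "winding_number (p +++ q) 0 = 0"
    by (intro winding_number_zero_in_outside) (use p q ends in auto)
  then have "Re n = 0"
    using wn by (simp add: complex_add_cnj)
  \<comment> \<open>Then \<open>b / a = exp (2 * pi * \<i> * n)\<close> would be positive.\<close>
  then have "2 * pi * \<i> * n = of_real (- 2 * pi * Im n)"
    by (simp add: complex_eq_iff)
  moreover have "of_real b - 0 = exp (2 * pi * \<i> * n) * (of_real a - 0)"
    using winding_number_exp_2pi[OF p] ends(1,2) unfolding n_def by metis
  ultimately have "complex_of_real b = exp (of_real (- 2 * pi * Im n)) * of_real a"
    by (simp only: diff_zero)
  then have "complex_of_real b = of_real (exp (- 2 * pi * Im n) * a)"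
    by (metis exp_of_real of_real_mult)
  then have "b = exp (- 2 * pi * Im n) * a"
    using of_real_eq_iff by blast
  moreover have "exp (- 2 * pi * Im n) * a < 0"
    using ends by (simp add: mult_pos_neg)
  ultimately show False
    using ends by simp
qed

text \<open>A two-constants estimate for the centre of the disc without harmonic measure: the product of \<open>m\<close> and
its reflection is at most \<open>M e\<close> on a closed curve around \<open>0\<close>, since at each point of this curve one of
the two factors is evaluated on \<open>p\<close>.\<close>

lemma symmetrized_maximum_principle:
  fixes m :: "complex \<Rightarrow> complex"
  assumes m: "m holomorphic_on ball 0 1" "\<And>z. z \<in> ball 0 1 \<Longrightarrow> norm (m z) \<le> M"
    and p: "path p" "path_image p \<subseteq> ball 0 1" "0 \<notin> path_image p"
    and ends: "pathstart p = of_real a" "pathfinish p = of_real b" "a < 0" "0 < b"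
    and e: "\<And>z. z \<in> path_image p \<Longrightarrow> norm (m z) \<le> e"
  shows "(norm (m 0))\<^sup>2 \<le> M * e"
proof -
  define K where "K = path_image p \<union> cnj ` path_image p"
  define F where "F = (\<lambda>z. m z * cnj (m (cnj z)))"
  have cnj_ball: "cnj ` ball 0 1 = ball 0 1"
    using image_iff[of _ cnj "ball 0 1"] by (auto intro!: image_eqI[of _ cnj "cnj _"])
  have "(cnj \<circ> m \<circ> cnj) holomorphic_on ball 0 1"
    using m(1) by (intro holomorphic_on_compose_cnj_cnj) (auto simp: cnj_ball)
  then have F: "F holomorphic_on ball 0 1"
    unfolding F_def o_def by (intro holomorphic_intros m(1))
  have KB: "K \<subseteq> ball 0 1"
    using p(2) cnj_ball unfolding K_def by blast
  have "compact K"
    unfolding K_def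
    by (intro compact_Un compact_path_image p compact_continuous_image continuous_intros)
  then have "closed K"
    by (rule compact_imp_closed)
  have ins: "inside K \<subseteq> ball 0 1"
    using outside_subset_convex[OF convex_ball KB] inside_Un_outside[of K] inside_Int_outside[of K]
    by blast
  have clo: "closure (inside K) \<subseteq> ball 0 1"
    using closure_inside_subset[OF \<open>closed K\<close>] ins KB by blast
  have "norm (F 0) \<le> M * e"
  proof (rule maximum_modulus_frontier[of F "inside K"])
    show "F holomorphic_on interior (inside K)"
      using F holomorphic_on_subset ins interior_subset by (metis subset_trans)
    show "continuous_on (closure (inside K)) F"
      using F clo holomorphic_on_imp_continuous_on continuous_on_subset by blast
    show "bounded (inside K)"
      using ins bounded_ball bounded_subset by blast
    show "0 \<in> inside K"
      unfolding K_def using p ends by (intro zero_inside_symmetrized_path)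
    show "norm (F z) \<le> M * e" if "z \<in> frontier (inside K)" for z
    proof -
      have z: "z \<in> K"
        using that frontier_inside_subset[OF \<open>closed K\<close>] by blast
      then have "z \<in> ball 0 1" "cnj z \<in> ball 0 1"
        using KB by (auto simp: subset_iff)
      then have M: "norm (m z) \<le> M" "norm (m (cnj z)) \<le> M"
        using m(2) by blast+
      from z consider "z \<in> path_image p" | "cnj z \<in> path_image p"
        unfolding K_def by fastforce
      then show ?thesis
      proof cases
        case 1
        then have "norm (m (cnj z)) * norm (m z) \<le> M * e"
          using M e by (intro mult_mono) (auto intro: order_trans[OF norm_ge_zero])
        then show ?thesis
          by (simp add: F_def norm_mult mult.commute)
      next
        case 2
        then have "norm (m z) * norm (m (cnj z)) \<le> M * e"
          using M e by (intro mult_mono) (auto intro: order_trans[OF norm_ge_zero])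
        then show ?thesis
          by (simp add: F_def norm_mult)
      qed
    qed
  qed
  then show ?thesis
    by (simp add: F_def norm_mult power2_eq_square)
qed

section \<open>Univalent functions with an omitted value\<close>

text \<open>Since \<open>u\<close> covers the disc of radius \<open>1\<close> about \<open>1\<close>, its square root covers a neighbourhood of \<open>1\<close>.
By injectivity of \<open>u\<close> the root then takes no value in the neighbourhood of \<open>-1\<close>, as the square of such
a value is attained near \<open>1\<close> already.\<close>

lemma sqrt_avoids_minus_one:
  assumes u: "u holomorphic_on ball 0 1" "inj_on u (ball 0 1)" "u 0 = 1"
    and nz: "\<And>z. z \<in> ball 0 1 \<Longrightarrow> u z \<noteq> 0" and sub: "ball 1 1 \<subseteq> u ` ball 0 1"
  obtains v where "v holomorphic_on ball 0 1" "v 0 = 1"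
    "\<And>z. z \<in> ball 0 1 \<Longrightarrow> u z = (v z)\<^sup>2"
    "\<And>z. z \<in> ball 0 1 \<Longrightarrow> 2/5 \<le> norm (v z + 1)"
proof -
  obtain v0 where v0: "v0 holomorphic_on ball 0 1" "\<And>z. z \<in> ball 0 1 \<Longrightarrow> u z = (v0 z)\<^sup>2"
    using contractible_imp_holomorphic_sqrt[OF u(1) convex_imp_contractible[OF convex_ball] nz]
    by metis
  have "(v0 0)\<^sup>2 = 1"
    using v0(2)[of 0] u(3) by simp
  then have v00: "v0 0 = 1 \<or> v0 0 = -1"
    by (simp add: power2_eq_1_iff)
  define v where "v = (\<lambda>z. v0 0 * v0 z)"
  have v: "v holomorphic_on ball 0 1" "v 0 = 1" "\<And>z. z \<in> ball 0 1 \<Longrightarrow> u z = (v z)\<^sup>2"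
    using v0 v00 by (auto simp: v_def intro!: holomorphic_intros)
  obtain h where h: "homeomorphism (ball 0 1) (u ` ball 0 1) u h"
    using invariance_of_domain_homeomorphism[of "ball 0 1" u] u(1,2) holomorphic_on_imp_continuous_on
    by blast
  \<comment> \<open>The branch of the square root on \<open>ball 1 1\<close> given by \<open>v\<close>; its values stay in the right half-plane.\<close>
  define V where "V = v ` h ` ball 1 1"
  have hV: "h ` ball 1 1 \<subseteq> ball 0 1"
    using homeomorphism_image2[OF h] image_mono[OF sub, of h] by blast
  have hu: "u (h s) = s" if "s \<in> ball 1 1" for s
    using h sub that by (meson homeomorphism_apply2 subsetD)
  have uh: "h (u z) = z" if "z \<in> ball 0 1" for z
    using h that by (meson homeomorphism_apply1)
  have "connected V"
    unfolding V_def
    by (intro connected_continuous_image connected_ball continuous_on_subset[OF _ hV]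
        holomorphic_on_imp_continuous_on v continuous_on_subset[OF homeomorphism_cont2[OF h] sub])
  have sq: "s\<^sup>2 \<in> ball 1 1" if s: "s \<in> V" for s
  proof -
    obtain x where "x \<in> ball 1 1" "s = v (h x)"
      using s by (auto simp: V_def)
    then show ?thesis
      using hu[of x] hV v(3)[of "h x"] by (simp add: image_subset_iff)
  qed
  have Re0: "Re s \<noteq> 0" if "s \<in> V" for s
  proof
    assume "Re s = 0"
    then have "Re (1 - s\<^sup>2) \<ge> 1"
      by (simp add: power2_eq_square)
    then show False
      using sq[OF that] complex_Re_le_cmod[of "1 - s\<^sup>2"] by (simp add: dist_norm)
  qed
  have "1 \<in> V"
    using v(2) uh[of 0] u(3) unfolding V_def by force
  have Re_pos: "0 < Re s" if "s \<in> V" for s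
  proof (rule ccontr)
    assume "\<not> 0 < Re s"
    moreover have "connected (Re ` V)"
      by (intro connected_continuous_image \<open>connected V\<close> continuous_intros)
    ultimately have "0 \<in> Re ` V"
      using \<open>1 \<in> V\<close> that by (intro connectedD_interval[of "Re ` V" "Re s" 1 0]) force+
    then show False
      using Re0 by force
  qed
  \<comment> \<open>If \<open>v z\<close> were within \<open>2/5\<close> of \<open>-1\<close>, then \<open>|(v z)\<^sup>2 - 1| \<le> 2/5 * 12/5 < 1\<close>, so \<open>v z \<in> V\<close>.\<close>
  have "2/5 \<le> norm (v z + 1)" if z: "z \<in> ball 0 1" for z
  proof (rule ccontr)
    assume "\<not> ?thesis"
    then have lt: "norm (v z + 1) < 2/5" by simp
    have "norm (v z - 1) \<le> norm (v z + 1) + norm (2::complex)"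
      using norm_triangle_ineq4[of "v z + 1" 2] by simp
    then have "norm (v z - 1) \<le> 12/5"
      using lt by simp
    then have "norm (v z + 1) * norm (v z - 1) \<le> 2/5 * (12/5)"
      using lt by (intro mult_mono) auto
    moreover have "(v z + 1) * (v z - 1) = (v z)\<^sup>2 - 1"
      by (simp add: algebra_simps power2_eq_square)
    ultimately have "norm ((v z)\<^sup>2 - 1) < 1"
      by (simp flip: norm_mult)
    then have "u z \<in> ball 1 1"
      using v(3)[OF z] by (simp add: dist_norm norm_minus_commute)
    then have "v z \<in> V"
      using uh[OF z] unfolding V_def by force
    then have "0 < Re (v z)"
      by (rule Re_pos)
    then show False
      using lt complex_Re_le_cmod[of "v z + 1"] by simp
  qed
  with v show thesis using that by blast
qed

text \<open>A weak form of the Beurling projection estimate: the boundary of the image comes as close as \<open>\<Delta>\<close> to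
\<open>g 0\<close>, so the part of the disc where \<open>g\<close> is at distance at least \<open>150 \<Delta>\<close> from \<open>g 0\<close> has small
harmonic measure from the centre, whereas a path from the negative to the positive radius would have a
definite one.\<close>

lemma no_far_path_across_center:
  assumes g: "g holomorphic_on ball 0 1" "inj_on g (ball 0 1)"
    and w: "w \<notin> g ` ball 0 1" "dist (g 0) w = \<Delta>" "ball (g 0) \<Delta> \<subseteq> g ` ball 0 1"
    and p: "path p" "path_image p \<subseteq> ball 0 1"
    and ends: "pathstart p = of_real a" "pathfinish p = of_real b" "a < 0" "0 < b"
    and R: "\<And>z. z \<in> path_image p \<Longrightarrow> 150 * \<Delta> \<le> dist (g 0) (g z)"
  shows False
proof -
  have "w \<noteq> g 0"
    using w(1) by auto
  then have \<Delta>: "\<Delta> > 0"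
    using w(2) by auto
  define c where "c = g 0 - w"
  have c: "c \<noteq> 0" "norm c = \<Delta>"
    using w(2) \<Delta> by (auto simp: c_def dist_norm)
  define u where "u = (\<lambda>z. (g z - w) / c)"
  have u: "u holomorphic_on ball 0 1" "inj_on u (ball 0 1)" "u 0 = 1"
    using g c by (auto simp: u_def inj_on_def c_def intro!: holomorphic_intros)
  have nz: "u z \<noteq> 0" if "z \<in> ball 0 1" for z
    using w(1) that c by (auto simp: u_def)
  have sub: "ball 1 1 \<subseteq> u ` ball 0 1"
  proof
    fix s :: complex assume s: "s \<in> ball 1 1"
    have "norm ((1 - s) * c) < \<Delta>"
      using s c \<Delta> by (simp add: norm_mult dist_norm)
    moreover have "g 0 - (w + s * c) = (1 - s) * c"
      by (simp add: c_def algebra_simps)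
    ultimately have "w + s * c \<in> ball (g 0) \<Delta>"
      by (simp add: dist_norm)
    then obtain z where "z \<in> ball 0 1" "g z = w + s * c"
      using w(3) by (metis imageE subsetD)
    then show "s \<in> u ` ball 0 1"
      using c by (intro image_eqI[of _ _ z]) (auto simp: u_def)
  qed
  obtain v where v: "v holomorphic_on ball 0 1" "v 0 = 1"
    "\<And>z. z \<in> ball 0 1 \<Longrightarrow> u z = (v z)\<^sup>2" "\<And>z. z \<in> ball 0 1 \<Longrightarrow> 2/5 \<le> norm (v z + 1)"
    using sqrt_avoids_minus_one[OF u nz sub] by metis
  have v1: "v z + 1 \<noteq> 0" if "z \<in> ball 0 1" for z
    using v(4)[OF that] by auto
  define m where "m = (\<lambda>z. 1 / (v z + 1))"
  have m: "m holomorphic_on ball 0 1"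
    unfolding m_def using v1 by (intro holomorphic_intros v) auto
  have mM: "norm (m z) \<le> 5/2" if "z \<in> ball 0 1" for z
  proof -
    have "1 / norm (v z + 1) \<le> 1 / (2/5)"
      using v(4)[OF that] by (intro divide_left_mono) auto
    then show ?thesis
      by (simp add: m_def norm_divide)
  qed
  \<comment> \<open>The factor \<open>150\<close> is chosen so that \<open>149 \<ge> 12\<^sup>2\<close>, and \<open>5/2 * 1/11 < (1/2)\<^sup>2\<close>.\<close>
  have e: "norm (m z) \<le> 1/11" if "z \<in> path_image p" for z
  proof -
    have z: "z \<in> ball 0 1"
      using that p by blast
    have "dist (g 0) (g z) \<le> dist (g 0) w + dist (g z) w"
      by (metis dist_triangle dist_commute)
    then have "149 * \<Delta> \<le> norm (g z - w)"
      using R[OF that] w(2) by (simp add: dist_norm)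
    then have "149 \<le> norm (u z)"
      using c \<Delta> by (simp add: u_def norm_divide field_simps)
    then have "12\<^sup>2 \<le> (norm (v z))\<^sup>2"
      using v(3)[OF z] by (simp add: norm_power)
    then have "12 \<le> norm (v z)"
      by (rule power2_le_imp_le) simp
    then have "11 \<le> norm (v z + 1)"
      using norm_triangle_ineq4[of "v z + 1" 1] by simp
    then have "1 / norm (v z + 1) \<le> 1 / 11"
      by (intro divide_left_mono) auto
    then show ?thesis
      by (simp add: m_def norm_divide)
  qed
  have "0 \<notin> path_image p"
    using R \<Delta> by force
  have "(norm (m 0))\<^sup>2 \<le> 5/2 * (1/11)"
    using symmetrized_maximum_principle[OF m mM p \<open>0 \<notin> path_image p\<close> ends e] by simp
  moreover have "norm (m 0) = 1/2"
    by (simp add: m_def v(2))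
  ultimately show False
    by (simp add: power2_eq_square)
qed

text \<open>The case of an arbitrary real base point follows by the disc automorphism that moves \<open>a\<close> to
the centre, because it preserves the diameter and its orientation.\<close>

lemma no_far_return_on_diameter:
  fixes F :: "complex \<Rightarrow> complex" and a s1 s2 :: real
  assumes F: "F holomorphic_on ball 0 1" "inj_on F (ball 0 1)"
    and s: "-1 < s1" "s1 < a" "a < s2" "s2 < 1"
    and w: "w \<notin> F ` ball 0 1" "dist (F a) w = \<Delta>" "ball (F a) \<Delta> \<subseteq> F ` ball 0 1"
    and A: "path_connected A" "A \<subseteq> F ` ball 0 1" "F s1 \<in> A" "F s2 \<in> A"
    and far: "\<And>x. x \<in> A \<Longrightarrow> 150 * \<Delta> \<le> dist (F a) x"
  shows False
proof -
  define \<phi> where "\<phi> = Moebius_function 0 (- complex_of_real a)"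
  define \<psi> where "\<psi> = Moebius_function 0 (complex_of_real a)"
  have a1: "norm (complex_of_real a) < 1"
    using s by simp
  have \<phi>B: "\<phi> z \<in> ball 0 1" and \<psi>B: "\<psi> z \<in> ball 0 1" if "z \<in> ball 0 1" for z
    using that a1 Moebius_function_norm_lt_1[of "- complex_of_real a" z 0]
      Moebius_function_norm_lt_1[of "complex_of_real a" z 0] by (simp_all add: \<phi>_def \<psi>_def)
  have \<phi>\<psi>: "\<phi> (\<psi> z) = z" and \<psi>\<phi>: "\<psi> (\<phi> z) = z" if "z \<in> ball 0 1" for z
    using that a1 Moebius_function_compose[of "complex_of_real a" "- complex_of_real a" z]
      Moebius_function_compose[of "- complex_of_real a" "complex_of_real a" z]
    by (simp_all add: \<phi>_def \<psi>_def)
  have \<phi>im: "\<phi> ` ball 0 1 = ball 0 1"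
    using \<phi>B \<psi>B \<phi>\<psi> by (metis image_eqI image_subsetI subsetI subset_antisym)
  have hol: "\<phi> holomorphic_on ball 0 1" "\<psi> holomorphic_on ball 0 1"
    using a1 by (auto simp: \<phi>_def \<psi>_def intro!: Moebius_function_holomorphic)
  have \<phi>0: "\<phi> 0 = of_real a"
    by (simp add: \<phi>_def Moebius_function_of_zero)
  define g where "g = F \<circ> \<phi>"
  have g: "g holomorphic_on ball 0 1" "inj_on g (ball 0 1)" "g ` ball 0 1 = F ` ball 0 1" "g 0 = F a"
  proof -
    show "g holomorphic_on ball 0 1"
      unfolding g_def using F(1) hol(1) by (intro holomorphic_on_compose) (simp_all add: \<phi>im)
    show "inj_on g (ball 0 1)"
      unfolding g_def using F(2) inj_on_inverseI[of "ball 0 1" \<psi> \<phi>, OF \<psi>\<phi>]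
      by (intro comp_inj_on) (simp_all add: \<phi>im)
    show "g ` ball 0 1 = F ` ball 0 1"
      unfolding g_def by (metis \<phi>im image_comp)
  qed (simp add: g_def \<phi>0)
  obtain h where h: "homeomorphism (ball 0 1) (F ` ball 0 1) F h"
    using invariance_of_domain_homeomorphism[of "ball 0 1" F] F holomorphic_on_imp_continuous_on
    by blast
  have hB: "h x \<in> ball 0 1" "F (h x) = x" if "x \<in> F ` ball 0 1" for x
    using that homeomorphism_image2[OF h] homeomorphism_apply2[OF h] by auto
  obtain p where p: "path p" "path_image p \<subseteq> A" "pathstart p = F s1" "pathfinish p = F s2"
    using A unfolding path_connected_def by blast
  have pG: "path_image p \<subseteq> F ` ball 0 1"
    using p A by blast
  define q where "q = \<psi> \<circ> (h \<circ> p)"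
  have "path (h \<circ> p)"
    using p(1) continuous_on_subset[OF homeomorphism_cont2[OF h] pG] by (rule path_continuous_image)
  moreover have hp: "path_image (h \<circ> p) \<subseteq> ball 0 1"
    using hB pG by (auto simp: path_image_compose)
  ultimately have "path q"
    unfolding q_def
    using holomorphic_on_imp_continuous_on[OF hol(2)] continuous_on_subset path_continuous_image by blast
  have q_im: "path_image q = \<psi> ` h ` path_image p"
    by (simp add: q_def path_image_compose image_comp)
  have qB: "path_image q \<subseteq> ball 0 1"
    unfolding q_im using \<psi>B hp by (auto simp: path_image_compose)
  have real: "\<psi> (h (F s)) = of_real ((s - a) / (1 - a * s))" if "-1 < s" "s < 1" for s :: real
  proof -
    have "h (F s) = s"
      using that by (intro homeomorphism_apply1[OF h]) auto
    then show ?thesis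
      by (simp add: \<psi>_def Moebius_function_simple)
  qed
  have pos: "0 < 1 - a * s" if "-1 < s" "s < 1" for s
  proof -
    have "\<bar>a * s\<bar> < 1 * 1"
      unfolding abs_mult using s that by (intro mult_strict_mono') auto
    then show ?thesis by simp
  qed
  show False
  proof (rule no_far_path_across_center[OF g(1,2)])
    show "w \<notin> g ` ball 0 1" "dist (g 0) w = \<Delta>" "ball (g 0) \<Delta> \<subseteq> g ` ball 0 1"
      using w g by simp_all
    show "path q" "path_image q \<subseteq> ball 0 1"
      by fact+
    show "pathstart q = of_real ((s1 - a) / (1 - a * s1))" "pathfinish q = of_real ((s2 - a) / (1 - a * s2))"
      using p(3,4) s real[of s1] real[of s2] by (simp_all add: q_def pathstart_compose pathfinish_compose)
    show "(s1 - a) / (1 - a * s1) < 0" "0 < (s2 - a) / (1 - a * s2)"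
      using s pos[of s1] pos[of s2] by (auto intro: divide_neg_pos divide_pos_pos)
    fix y assume "y \<in> path_image q"
    then obtain x where x: "x \<in> path_image p" "y = \<psi> (h x)"
      unfolding q_im by blast
    then have "x \<in> F ` ball 0 1"
      using pG by blast
    then have "g y = x"
      using x(2) hB[of x] \<phi>\<psi>[of "h x"] by (simp add: g_def)
    then show "150 * \<Delta> \<le> dist (g 0) (g y)"
      using far[of x] x p(2) g(4) by auto
  qed
qed

section \<open>Separation in domains homeomorphic to the plane\<close>

lemma homeomorphism_Diff_image:
  assumes "homeomorphism X UNIV h k" "S \<subseteq> X"
  shows "homeomorphism (X - S) (- (h ` S)) h k"
proof (rule homeomorphism_of_subsets[OF assms(1)])
  have "inj_on h X" "h ` X = UNIV"
    using assms(1) by (auto simp: homeomorphism_def intro: inj_on_inverseI)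
  then show "h ` (X - S) = - h ` S"
    using assms(2) by (simp add: inj_on_image_set_diff Compl_eq_Diff_UNIV)
qed auto

text \<open>The following two facts transport the corresponding ones for closed subsets of the plane; the separating
sets are relatively closed in the domain and may reach its boundary.\<close>

lemma component_separates_plane_domain:
  fixes X :: "'a::euclidean_space set"
  assumes X: "X homeomorphic (UNIV :: 'a set)" and S: "closedin (top_of_set X) S"
    and ab: "a \<in> X" "b \<in> X" "\<not> connected_component (X - S) a b"
  obtains C where "C \<in> components S" "\<not> connected_component (X - C) a b"
proof -
  obtain h k where hk: "homeomorphism X (UNIV :: 'a set) h k"
    using X unfolding homeomorphic_def by blast
  have SX: "S \<subseteq> X"
    using S closedin_imp_subset by blast
  have kh: "k (h x) = x" if "x \<in> X" for x
    using homeomorphism_apply1[OF hk that] .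
  have "closed (h ` S)"
    using homeomorphism_imp_closed_map[OF hk S] by simp
  moreover have "\<not> connected_component (- (h ` S)) (h a) (h b)"
  proof
    assume "connected_component (- (h ` S)) (h a) (h b)"
    then have "connected_component (X - S) (k (h a)) (k (h b))"
      by (rule connected_component_homeomorphismI[OF homeomorphism_symD[OF homeomorphism_Diff_image[OF hk SX]]])
    then show False
      using ab kh by simp
  qed
  ultimately obtain C' where C': "C' \<in> components (h ` S)"
      "\<not> connected_component (- C') (h a) (h b)"
    using separation_by_component_closed_pointwise by blast
  then obtain y where y: "y \<in> h ` S" "C' = connected_component_set (h ` S) y"
    unfolding components_def by blast
  have hS: "homeomorphism (h ` S) S k h"
    using homeomorphism_of_subsets[OF hk SX] homeomorphism_symD by blast
  have "k ` C' = connected_component_set S (k y)"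
    using connected_component_set_homeomorphism[OF hS y(1)] y(2) by simp
  moreover have "k y \<in> S"
    using y(1) kh SX by (metis imageE subsetD)
  ultimately have C: "k ` C' \<in> components S"
    unfolding components_def by blast
  then have CX: "k ` C' \<subseteq> X"
    using in_components_subset SX by blast
  have hkC: "h ` k ` C' = C'"
    using homeomorphism_apply2[OF hk] by (auto simp: image_comp)
  have "\<not> connected_component (X - k ` C') a b"
  proof
    assume "connected_component (X - k ` C') a b"
    then have "connected_component (- (h ` k ` C')) (h a) (h b)"
      by (rule connected_component_homeomorphismI[OF homeomorphism_Diff_image[OF hk CX]])
    then show False
      using C'(2) hkC by simp
  qed
  with C show thesis using that by blast
qed

lemma disjoint_Un_separates_plane_domain:
  fixes X :: "'a::euclidean_space set"
  assumes X: "X homeomorphic (UNIV :: 'a set)"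
    and S: "closedin (top_of_set X) S" and T: "closedin (top_of_set X) T" and "S \<inter> T = {}"
    and conS: "connected_component (X - S) a b" and conT: "connected_component (X - T) a b"
  shows "connected_component (X - (S \<union> T)) a b"
proof -
  obtain h k where hk: "homeomorphism X (UNIV :: 'a set) h k"
    using X unfolding homeomorphic_def by blast
  have sub: "S \<subseteq> X" "T \<subseteq> X"
    using S T closedin_imp_subset by blast+
  have ab: "a \<in> X" "b \<in> X"
    using connected_component_in[OF conS] by auto
  have "connected_component (- (h ` S \<union> h ` T)) (h a) (h b)"
  proof (rule separation_by_Un_closed_pointwise)
    show "closed (h ` S)" "closed (h ` T)"
      using homeomorphism_imp_closed_map[OF hk S] homeomorphism_imp_closed_map[OF hk T] by simp_all
    show "h ` S \<inter> h ` T = {}"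
    proof -
      have "inj_on h X"
        using homeomorphism_apply1[OF hk] by (rule inj_on_inverseI)
      then show ?thesis
        using inj_on_image_Int[of h X S T] sub \<open>S \<inter> T = {}\<close> by simp
    qed
    show "connected_component (- h ` S) (h a) (h b)" "connected_component (- h ` T) (h a) (h b)"
      using connected_component_homeomorphismI[OF homeomorphism_Diff_image[OF hk]] sub conS conT
      by blast+
  qed
  then have "connected_component (- (h ` (S \<union> T))) (h a) (h b)"
    by (simp add: image_Un)
  then have "connected_component (X - (S \<union> T)) (k (h a)) (k (h b))"
    by (rule connected_component_homeomorphismI[OF homeomorphism_symD[OF homeomorphism_Diff_image[OF hk]], rotated])
      (use sub in auto)
  then show ?thesis
    using ab homeomorphism_apply1[OF hk] by simp
qed

lemma univalent_image_homeomorphic_plane: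
  assumes "F holomorphic_on ball 0 1" "inj_on F (ball 0 1)"
  shows "F ` ball 0 1 homeomorphic (UNIV :: complex set)"
proof -
  obtain h where "homeomorphism (ball 0 1) (F ` ball 0 1) F h"
    using invariance_of_domain_homeomorphism[of "ball 0 1" F] assms holomorphic_on_imp_continuous_on
    by blast
  then have "F ` ball 0 1 homeomorphic ball (0::complex) 1"
    using homeomorphic_def homeomorphic_sym by blast
  then show ?thesis
    using homeomorphic_ball01_UNIV homeomorphic_trans by blast
qed

text \<open>The circles bounding the two discs have the point \<open>\<zeta>\<close> in common.  An inversion at \<open>\<zeta>\<close> sends both of
them to straight lines, and the difference of the discs to an intersection of two half-planes.\<close>

lemma connected_ball_Diff_cball:
  fixes \<zeta> :: complex
  assumes "\<zeta> \<in> sphere c s" "\<zeta> \<in> sphere z r"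
  shows "connected (ball c s - cball z r)"
proof -
  define a where "a = \<zeta> - c"
  define b where "b = \<zeta> - z"
  have ab: "norm a = s" "norm b = r"
    using assms by (auto simp: a_def b_def dist_norm norm_minus_commute)
  \<comment> \<open>The image of the difference of the discs under \<open>x \<mapsto> inverse (x - \<zeta>)\<close>.\<close>
  define Y where "Y = {y. Re (a * y) < -1/2} \<inter> {y. Re (b * y) > -1/2}"
  have Re: "Re (d * y) = inner (cnj d) y" for d y
    by (simp add: inner_complex_def)
  have "convex Y"
    unfolding Y_def Re by (intro convex_Int convex_halfspace_lt convex_halfspace_gt)
  have key: "(norm (d + inverse y))\<^sup>2 * (norm y)\<^sup>2 = (norm d)\<^sup>2 * (norm y)\<^sup>2 + (2 * Re (d * y) + 1)"
    if "y \<noteq> 0" for d y :: complex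
  proof -
    have "norm (d + inverse y) * norm y = norm (d * y + 1)"
      using that by (simp flip: norm_mult add: distrib_right)
    then have "(norm (d + inverse y))\<^sup>2 * (norm y)\<^sup>2 = (norm (d * y + 1))\<^sup>2"
      by (metis power_mult_distrib)
    also have "\<dots> = (norm (d * y))\<^sup>2 + (2 * Re (d * y) + 1)"
      by (simp only: cmod_power2) (simp add: power2_eq_square algebra_simps)
    finally show ?thesis
      by (simp add: norm_mult power_mult_distrib)
  qed
  have lt: "norm (d + inverse y) < norm d \<longleftrightarrow> Re (d * y) < -1/2"
    and gt: "norm (d + inverse y) > norm d \<longleftrightarrow> Re (d * y) > -1/2" if "y \<noteq> 0" for d y :: complex
  proof -
    have sq: "u < v \<longleftrightarrow> u\<^sup>2 * (norm y)\<^sup>2 < v\<^sup>2 * (norm y)\<^sup>2" if "0 \<le> u" "0 \<le> v" for u v :: real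
    proof -
      have "u < v \<longleftrightarrow> u\<^sup>2 < v\<^sup>2"
        using that power2_less_imp_less power_strict_mono[of u v 2] by auto
      then show ?thesis
        using \<open>y \<noteq> 0\<close> by simp
    qed
    show "norm (d + inverse y) < norm d \<longleftrightarrow> Re (d * y) < -1/2"
      by (subst sq) (use key[OF that, of d] in auto)
    show "norm (d + inverse y) > norm d \<longleftrightarrow> Re (d * y) > -1/2"
      by (subst sq) (use key[OF that, of d] in auto)
  qed
  have Y0: "0 \<notin> Y"
    by (simp add: Y_def)
  have shift: "\<zeta> + inverse y - c = a + inverse y" "\<zeta> + inverse y - z = b + inverse y" for y
    by (simp_all add: a_def b_def)
  have mem: "\<zeta> + inverse y \<in> ball c s - cball z r \<longleftrightarrow> y \<in> Y" if "y \<noteq> 0" for y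
  proof -
    have "dist c (\<zeta> + inverse y) = norm (a + inverse y)" "dist z (\<zeta> + inverse y) = norm (b + inverse y)"
      by (metis shift dist_norm dist_commute)+
    then have "\<zeta> + inverse y \<in> ball c s \<longleftrightarrow> norm (a + inverse y) < norm a"
      and "\<zeta> + inverse y \<notin> cball z r \<longleftrightarrow> norm (b + inverse y) > norm b"
      by (simp_all add: ab not_le)
    then show ?thesis
      using lt[OF that, of a] gt[OF that, of b] by (auto simp: Y_def)
  qed
  have "ball c s - cball z r = (\<lambda>y. \<zeta> + inverse y) ` Y"
  proof (intro equalityI subsetI)
    fix x assume x: "x \<in> ball c s - cball z r"
    then have "x \<noteq> \<zeta>"
      using assms by auto
    then have "inverse (x - \<zeta>) \<in> Y"
      using mem[of "inverse (x - \<zeta>)"] x by simp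
    then show "x \<in> (\<lambda>y. \<zeta> + inverse y) ` Y"
      by (intro image_eqI[of _ _ "inverse (x - \<zeta>)"]) auto
  next
    fix x assume "x \<in> (\<lambda>y. \<zeta> + inverse y) ` Y"
    then obtain y where y: "y \<in> Y" "x = \<zeta> + inverse y"
      by blast
    then have "y \<noteq> 0"
      using Y0 by blast
    then show "x \<in> ball c s - cball z r"
      using mem[of y] y by simp
  qed
  moreover have "connected ((\<lambda>y. \<zeta> + inverse y) ` Y)"
    using Y0 by (intro connected_continuous_image convex_connected \<open>convex Y\<close> continuous_intros) auto
  ultimately show ?thesis
    by simp
qed

section \<open>Arcs of circles as crosscuts\<close>

text \<open>The circle minus the point \<open>e\<close> is parametrized by the angle measured from \<open>e\<close>.  The component \<open>A\<close>
corresponds to a component of an open set of angles, that is, to an open interval.\<close>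

lemma circle_component_crosscut:
  fixes G :: "complex set"
  assumes G: "open G" and r: "r > 0" and e: "e \<in> sphere z r" "e \<notin> G"
    and A: "A \<in> components (sphere z r \<inter> G)"
  shows "crosscut G A"
proof -
  define q where "q = (\<lambda>x::real. z + (e - z) * exp (\<i> * of_real x))"
  define j where "j = (\<lambda>y. Arg2pi ((y - z) / (e - z)))"
  have ez: "e \<noteq> z" "norm (e - z) = r"
    using e r by (auto simp: dist_norm norm_minus_commute)
  have qc: "continuous_on S q" for S
    unfolding q_def by (intro continuous_intros)
  have q_sphere: "q x \<in> sphere z r" for x
    using ez by (simp add: q_def dist_norm norm_mult)
  have jq: "j (q x) = x" if "0 < x" "x < 2 * pi" for x
    using that ez by (auto simp: j_def q_def intro!: Arg2pi_unique[of 1])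
  have qj: "q (j y) = y" if "y \<in> sphere z r" for y
  proof -
    have "norm ((y - z) / (e - z)) = 1"
      using that ez r by (simp add: norm_divide dist_norm norm_minus_commute)
    then have "(y - z) / (e - z) = exp (\<i> * of_real (j y))"
      using Arg2pi_eq[of "(y - z) / (e - z)"] by (simp add: j_def)
    then show ?thesis
      using ez by (simp add: q_def field_simps)
  qed
  have q0: "q 0 = e" "q (2 * pi) = e"
    using exp_two_pi_i by (simp_all add: q_def mult_ac)
  have nonneg: "(y - z) / (e - z) \<notin> \<real>\<^sub>\<ge>\<^sub>0" if "y \<in> sphere z r - {e}" for y
  proof
    assume *: "(y - z) / (e - z) \<in> \<real>\<^sub>\<ge>\<^sub>0"
    then obtain u where u: "(y - z) / (e - z) = of_real u" "u \<ge> 0"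
      by (auto elim: nonneg_Reals_cases)
    have "norm ((y - z) / (e - z)) = 1"
      using that ez r by (simp add: norm_divide dist_norm norm_minus_commute)
    then have "(y - z) / (e - z) = 1"
      using u by simp
    then show False
      using that ez by simp
  qed
  have jc: "continuous_on (sphere z r - {e}) j"
    unfolding j_def
    by (rule continuous_on_compose2[of "- \<real>\<^sub>\<ge>\<^sub>0" Arg2pi])
      (use nonneg ez in \<open>auto intro!: continuous_intros continuous_at_imp_continuous_on continuous_at_Arg2pi\<close>)
  have jrange: "0 < j y" "j y < 2 * pi" if "y \<in> sphere z r - {e}" for y
  proof -
    show "j y < 2 * pi"
      by (simp add: j_def Arg2pi_lt_2pi)
    have "j y \<noteq> 0"
      using qj[of y] q0 that by force
    then show "0 < j y"
      using Arg2pi_ge_0[of "(y - z) / (e - z)"] by (simp add: j_def)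
  qed
  have AS: "A \<subseteq> sphere z r \<inter> G" "connected A" "A \<noteq> {}"
    using A in_components_subset in_components_connected in_components_nonempty by blast+
  then have Ae: "A \<subseteq> sphere z r - {e}"
    using e by auto
  define B where "B = j ` A"
  have qB: "q ` B = A"
    using qj AS by (force simp: B_def image_comp)
  have "connected B"
    unfolding B_def by (intro connected_continuous_image AS continuous_on_subset[OF jc Ae])
  have Bsub: "B \<subseteq> {0<..<2*pi}"
    unfolding B_def using jrange Ae by fastforce
  \<comment> \<open>Maximality of the component, in terms of angles.\<close>
  have Bmax: "x \<in> B" if "connected I" "I \<inter> B \<noteq> {}" "x \<in> I" "I \<subseteq> {0<..<2*pi}" "q ` I \<subseteq> G" for I x
  proof -
    have "q ` I \<subseteq> A"
    proof (rule components_maximal[OF A])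
      show "connected (q ` I)"
        by (intro connected_continuous_image qc that)
      show "q ` I \<subseteq> sphere z r \<inter> G"
        using that q_sphere by blast
      show "A \<inter> q ` I \<noteq> {}"
        using that(2) qB by blast
    qed
    then have "j (q x) \<in> B"
      using that by (auto simp: B_def)
    moreover have "j (q x) = x"
      using that by (intro jq) auto
    ultimately show ?thesis by simp
  qed
  define O' where "O' = {0<..<2*pi} \<inter> q -` G"
  have "open O'"
    unfolding O'_def by (intro open_Int open_vimage G qc open_greaterThanLessThan)
  have BO: "B \<subseteq> O'"
    using Bsub qB AS by (auto simp: O'_def)
  have "open B"
    unfolding open_dist
  proof
    fix x assume x: "x \<in> B"
    then obtain d where d: "d > 0" "ball x d \<subseteq> O'"
      using \<open>open O'\<close> BO by (meson openE subsetD)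
    have "ball x d \<inter> B \<noteq> {}"
      using d x by (metis IntI centre_in_ball empty_iff)
    have "ball x d \<subseteq> B"
    proof
      fix y assume "y \<in> ball x d"
      then show "y \<in> B"
        using d \<open>ball x d \<inter> B \<noteq> {}\<close>
        by (intro Bmax[of "ball x d"]) (auto simp: O'_def simp del: mem_ball)
    qed
    then show "\<exists>e>0. \<forall>y. dist y x < e \<longrightarrow> y \<in> B"
      using d by (intro exI[of _ d]) (auto simp: subset_iff dist_commute)
  qed
  define a where "a = Inf B"
  define b where "b = Sup B"
  have "B \<noteq> {}"
    using AS by (simp add: B_def)
  have bdd: "bdd_below B" "bdd_above B"
    using Bsub by (meson bdd_below_Ioo bdd_below_mono bdd_above_Ioo bdd_above_mono)+
  have Bab: "B = {a<..<b}"
  proof (intro equalityI subsetI)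
    fix x assume x: "x \<in> B"
    obtain d where d: "d > 0" "ball x d \<subseteq> B"
      using \<open>open B\<close> x by (meson openE)
    then have "x - d/2 \<in> B" "x + d/2 \<in> B"
      by (auto simp: subset_iff dist_real_def)
    then have "a \<le> x - d/2" "x + d/2 \<le> b"
      using bdd by (auto simp: a_def b_def intro: cInf_lower cSup_upper)
    then show "x \<in> {a<..<b}"
      using d by auto
  next
    fix x assume "x \<in> {a<..<b}"
    then obtain u v where "u \<in> B" "u < x" "v \<in> B" "x < v"
      using \<open>B \<noteq> {}\<close> bdd by (auto simp: a_def b_def cInf_less_iff less_cSup_iff)
    then show "x \<in> B"
      using \<open>connected B\<close> connectedD_interval[of B u v x] by simp
  qed
  then have "a < b"
    using \<open>B \<noteq> {}\<close> by auto
  have "closure B = {a..b}"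
    using Bab \<open>a < b\<close> by simp
  moreover have "closure B \<subseteq> {0..2*pi}"
    using closure_mono[OF Bsub] by simp
  ultimately have ab: "0 \<le> a" "b \<le> 2 * pi"
    using \<open>a < b\<close> by auto
  have "{a..b} = insert a (insert b B)"
    using Bab \<open>a < b\<close> by auto
  then have qab: "q ` {a..b} = A \<union> {q a, q b}"
    using qB by auto
  have clA: "closure A = A \<union> {q a, q b}"
  proof
    have "compact (q ` {a..b})"
      by (intro compact_continuous_image qc compact_Icc)
    moreover have "A \<subseteq> q ` {a..b}"
      using qab by blast
    ultimately show "closure A \<subseteq> A \<union> {q a, q b}"
      unfolding qab[symmetric] by (intro closure_minimal compact_imp_closed)
    have "q ` closure B \<subseteq> closure (q ` B)"
      by (intro image_closure_subset qc closed_closure closure_subset)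
    then show "A \<union> {q a, q b} \<subseteq> closure A"
      using qab qB \<open>closure B = {a..b}\<close> by simp
  qed
  have end_notin: "q x \<notin> G" if x: "x = a \<or> x = b" for x
  proof
    assume "q x \<in> G"
    then have "x \<noteq> 0" "x \<noteq> 2 * pi"
      using q0 e by auto
    then have "x \<in> O'"
      using x ab \<open>a < b\<close> \<open>q x \<in> G\<close> by (auto simp: O'_def)
    then obtain d where d: "d > 0" "ball x d \<subseteq> O'"
      using \<open>open O'\<close> by (meson openE)
    have "x \<in> closure B"
      using x \<open>closure B = {a..b}\<close> \<open>a < b\<close> by auto
    then have "ball x d \<inter> B \<noteq> {}"
      using d by (meson centre_in_ball closure_iff_nhds_not_empty disjoint_iff open_ball subset_refl)
    then have "x \<in> B"
      using d by (intro Bmax[of "ball x d"]) (auto simp: O'_def)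
    then show False
      using x Bab by auto
  qed
  have "closure A \<subseteq> closure G"
    using AS by (intro closure_mono) blast
  then have fr: "q a \<in> frontier G" "q b \<in> frontier G"
    using end_notin clA G by (auto simp: frontier_def interior_open)
  have "homeomorphism B A q j"
  proof (rule homeomorphismI)
    show "continuous_on A j"
      using continuous_on_subset[OF jc Ae] .
    show "q ` B \<subseteq> A" "j ` A \<subseteq> B"
      using qB by (auto simp: B_def)
    show "j (q x) = x" if "x \<in> B" for x
      using that Bsub by (intro jq) auto
    show "q (j y) = y" if "y \<in> A" for y
      using that AS by (intro qj) auto
  qed (rule qc)
  then have "A homeomorphic B"
    using homeomorphic_sym homeomorphic_def by blast
  moreover have "B homeomorphic {0<..<1::real}"
    unfolding Bab using homeomorphic_open_interval_UNIV[OF \<open>a < b\<close>]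
      homeomorphic_open_interval_UNIV[of 0 1] homeomorphic_sym homeomorphic_trans zero_less_one
    by blast
  ultimately have "A homeomorphic {0<..<1::real}"
    by (rule homeomorphic_trans)
  then show ?thesis
    unfolding crosscut_def using AS fr clA by blast
qed

lemma nearest_frontier_point:
  fixes G :: "'a::euclidean_space set"
  assumes "open G" "bounded G" "z \<in> G"
  obtains w where "w \<in> frontier G" "w \<notin> G" "dist z w = infdist z (frontier G)"
    "ball z (infdist z (frontier G)) \<subseteq> G" "0 < infdist z (frontier G)"
proof -
  let ?D = "infdist z (frontier G)"
  have "G \<noteq> UNIV"
    using assms by auto
  then have "frontier G \<noteq> {}"
    using assms frontier_not_empty by blast
  then obtain w where w: "w \<in> frontier G" "?D = dist z w"
    using infdist_attains_inf[of "frontier G" z] by auto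
  have disj: "frontier G \<inter> G = {}"
    using \<open>open G\<close> by (auto simp: frontier_def interior_open)
  then have "w \<notin> G"
    using w by blast
  moreover have "0 < ?D"
    using w(2) assms(3) \<open>w \<notin> G\<close> by (metis zero_less_dist_iff)
  moreover have "ball z ?D \<subseteq> G"
  proof (rule ccontr)
    assume "\<not> ?thesis"
    then have "ball z ?D \<inter> frontier G \<noteq> {}"
      using assms(3) \<open>0 < ?D\<close> by (intro connected_Int_frontier connected_ball) (auto simp: disjoint_iff)
    then obtain y where "y \<in> frontier G" "dist z y < ?D"
      by auto
    then show False
      using infdist_le[of y "frontier G" z] by simp
  qed
  ultimately show thesis
    using that w by simp
qed

text \<open>The circle separates \<open>F a\<close> from \<open>F 0\<close>, hence so does one of its components \<open>A\<close>.  The image of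
the radius meets \<open>A\<close> before \<open>F a\<close>, and therefore cannot meet it again later.\<close>

lemma short_crosscut_exists:
  fixes F :: "complex \<Rightarrow> complex" and a :: real
  assumes F: "F holomorphic_on ball 0 1" "inj_on F (ball 0 1)"
    and G: "G = F ` ball 0 1" "bounded G" "simply_connected G"
    and a: "0 \<le> a" "a < 1"
    and r: "r = 150 * infdist (F a) (frontier G)" "r < dist (F a) (F 0)"
  obtains A where "A \<subseteq> sphere (F a) r" "crosscut G A"
    "\<And>s::real. a < s \<Longrightarrow> s < 1 \<Longrightarrow> F s \<notin> A \<and> \<not> connected_component (G - A) (F 0) (F s)"
proof -
  define z where "z = F a"
  define \<Delta> where "\<Delta> = infdist z (frontier G)"
  have "open G"
    unfolding G using F by (intro open_mapping_thm3) auto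
  have "z \<in> G"
    using a by (auto simp: z_def G)
  have "F 0 \<in> G"
    by (auto simp: G)
  obtain w where w: "w \<notin> G" "dist z w = \<Delta>" "ball z \<Delta> \<subseteq> G" "0 < \<Delta>"
    using nearest_frontier_point[OF \<open>open G\<close> \<open>bounded G\<close> \<open>z \<in> G\<close>] unfolding \<Delta>_def by metis
  have r': "r = 150 * \<Delta>" "0 < r" "r < dist z (F 0)"
    using r w by (simp_all add: \<Delta>_def z_def)
  define S where "S = sphere z r \<inter> G"
  have S: "closedin (top_of_set G) S"
    unfolding S_def by (metis closed_sphere closedin_closed_Int inf_commute)
  have "\<not> connected_component (G - S) (F 0) z"
  proof
    assume "connected_component (G - S) (F 0) z"
    then obtain T where T: "connected T" "T \<subseteq> G - S" "F 0 \<in> T" "z \<in> T"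
      unfolding connected_component_def by blast
    have "T \<inter> frontier (cball z r) \<noteq> {}"
    proof (rule connected_Int_frontier[OF T(1)])
      have "z \<in> cball z r"
        using r' by simp
      then show "T \<inter> cball z r \<noteq> {}"
        using T by blast
      have "F 0 \<notin> cball z r"
        using r' by simp
      then show "T - cball z r \<noteq> {}"
        using T by blast
    qed
    then show False
      using T(2) by (auto simp: S_def)
  qed
  then obtain A where A: "A \<in> components S" "\<not> connected_component (G - A) (F 0) z"
    using component_separates_plane_domain[OF _ S \<open>F 0 \<in> G\<close> \<open>z \<in> G\<close>]
      univalent_image_homeomorphic_plane[OF F] G(1) by blast
  then have AS: "A \<subseteq> sphere z r" "A \<subseteq> G"
    using in_components_subset unfolding S_def by blast+
  obtain e where e: "e \<in> sphere z r" "e \<notin> G"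
  proof -
    \<comment> \<open>A full circle in the simply connected set \<open>G\<close> would force the omitted point \<open>w\<close> into \<open>G\<close>.\<close>
    have "\<not> sphere z r \<subseteq> G"
    proof
      assume "sphere z r \<subseteq> G"
      then have "inside (sphere z r) \<subseteq> G"
        by (rule subset_simply_connected_imp_inside_subset[OF G(3) \<open>open G\<close>])
      moreover have "inside (sphere z r) = ball z r"
        using inside_frontier_eq_interior[of "cball z r"] by simp
      moreover have "w \<in> ball z r"
        using w r' by simp
      ultimately show False
        using w by blast
    qed
    then show thesis using that by blast
  qed
  have cc: "crosscut G A"
    by (rule circle_component_crosscut[OF \<open>open G\<close> r'(2) e A(1)[unfolded S_def]])
  have pcA: "path_connected A"
  proof -
    have "path_connected {0<..<1::real}"
      by (intro convex_imp_path_connected) simp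
    then show ?thesis
      using cc homeomorphic_path_connectedness unfolding crosscut_def by blast
  qed
  have seg: "connected ((\<lambda>x::real. F x) ` {u..v})" "(\<lambda>x::real. F x) ` {u..v} \<subseteq> G"
    if "-1 < u" "v < 1" for u v :: real
  proof -
    have sub: "complex_of_real ` {u..v} \<subseteq> ball 0 1"
      using that by auto
    have "continuous_on {u..v} (\<lambda>x::real. F x)"
      by (rule continuous_on_compose2[OF holomorphic_on_imp_continuous_on[OF F(1)] _ sub])
        (intro continuous_intros)
    then show "connected ((\<lambda>x::real. F x) ` {u..v})"
      by (intro connected_continuous_image) auto
    show "(\<lambda>x::real. F x) ` {u..v} \<subseteq> G"
      using sub unfolding G by blast
  qed
  have "z \<notin> A"
    using AS r' by auto
  have "\<exists>s1\<in>{0..a}. F (complex_of_real s1) \<in> A"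
  proof (rule ccontr)
    assume "\<not> ?thesis"
    then have "(\<lambda>x::real. F x) ` {0..a} \<subseteq> G - A"
      using seg(2)[of 0 a] a by auto
    then have "connected_component (G - A) (F 0) z"
      using seg(1)[of 0 a] a unfolding connected_component_def z_def
      by (intro exI[of _ "(\<lambda>x::real. F x) ` {0..a}"]) (auto intro!: image_eqI[of _ _ 0])
    then show False
      using A by blast
  qed
  then obtain s1 where s1: "0 \<le> s1" "s1 \<le> a" "F (complex_of_real s1) \<in> A"
    by auto
  then have "s1 \<noteq> a"
    using \<open>z \<notin> A\<close> by (auto simp: z_def)
  have not_in: "F (complex_of_real s) \<notin> A" if "a < s" "s < 1" for s
  proof
    assume "F (complex_of_real s) \<in> A"
    then show False
      using no_far_return_on_diameter[OF F, of s1 a s w \<Delta> A] s1 \<open>s1 \<noteq> a\<close> that w pcA AS r'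
      unfolding G z_def by fastforce
  qed
  show thesis
  proof (rule that)
    show "A \<subseteq> sphere (F a) r"
      using AS by (simp add: z_def)
    show "crosscut G A"
      by fact
    fix s :: real assume s: "a < s" "s < 1"
    have "\<not> connected_component (G - A) (F 0) (F s)"
    proof
      assume 1: "connected_component (G - A) (F 0) (F s)"
      have "F (complex_of_real x) \<notin> A" if "x \<in> {a..s}" for x
        using not_in[of x] \<open>z \<notin> A\<close> that s by (cases "x = a") (auto simp: z_def)
      then have "(\<lambda>x::real. F x) ` {a..s} \<subseteq> G - A"
        using seg(2)[of a s] a s by auto
      then have "connected_component (G - A) (F s) z"
        using seg(1)[of a s] a s unfolding connected_component_def z_def
        by (intro exI[of _ "(\<lambda>x::real. F x) ` {a..s}"]) auto
      then show False
        using 1 A(2) connected_component_trans by blast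
    qed
    then show "F s \<notin> A \<and> \<not> connected_component (G - A) (F 0) (F s)"
      using not_in s by blast
  qed
qed

section \<open>The derivative of a radial Loewner chain at the origin\<close>

lemma norm_deriv_le_of_bounded:
  assumes "f holomorphic_on ball z0 R" "\<And>z. z \<in> ball z0 R \<Longrightarrow> norm (f z) \<le> B" "0 < r" "r < R"
  shows "norm (deriv f z0) \<le> B / r"
proof -
  have "cball z0 r \<subseteq> ball z0 R"
    using assms by auto
  then have "norm ((deriv ^^ 1) f z0) \<le> fact 1 * B / r ^ 1"
    using assms
    by (intro Cauchy_inequality holomorphic_on_subset[OF assms(1)]
        holomorphic_on_imp_continuous_on[OF holomorphic_on_subset[OF assms(1)]])
      (auto simp: dist_norm)
  then show ?thesis by simp
qed

text \<open>By Cauchy's formula the derivative at \<open>0\<close> is an integral over a circle, to which dominated convergence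
applies.  The Loewner equation provides only pointwise limits, so uniform convergence is not available directly.\<close>

lemma deriv_tendsto_of_pointwise_bounded:
  assumes F: "\<And>n::nat. F n holomorphic_on ball 0 1" and h: "h holomorphic_on ball 0 1"
    and lim: "\<And>z. z \<in> sphere 0 (1/2) \<Longrightarrow> (\<lambda>n. F n z) \<longlonglongrightarrow> h z"
    and bnd: "\<And>n z. z \<in> sphere 0 (1/2) \<Longrightarrow> norm (F n z) \<le> B"
  shows "(\<lambda>n. deriv (F n) 0) \<longlonglongrightarrow> deriv h 0"
proof -
  let ?c = "circlepath (0::complex) (1/2)"
  have eq: "deriv k 0 = 1 / (2 * of_real pi * \<i>) *
        integral {0..1} (\<lambda>x. k (?c x) / (?c x)\<^sup>2 * vector_derivative ?c (at x))"
    and int: "(\<lambda>x. k (?c x) / (?c x)\<^sup>2 * vector_derivative ?c (at x)) integrable_on {0..1}"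
    if k: "k holomorphic_on ball 0 1" for k
  proof -
    have "k holomorphic_on cball 0 (1/2)"
      using k by (rule holomorphic_on_subset) auto
    then have *: "continuous_on (cball 0 (1/2)) k" "k holomorphic_on ball 0 (1/2)"
      by (auto intro: holomorphic_on_imp_continuous_on holomorphic_on_subset)
    show "deriv k 0 = 1 / (2 * of_real pi * \<i>) *
        integral {0..1} (\<lambda>x. k (?c x) / (?c x)\<^sup>2 * vector_derivative ?c (at x))"
      using DERIV_imp_deriv[OF Cauchy_derivative_integral_circlepath(2)[OF *, of 0]]
      by (simp add: contour_integral_integral)
    show "(\<lambda>x. k (?c x) / (?c x)\<^sup>2 * vector_derivative ?c (at x)) integrable_on {0..1}"
      using Cauchy_derivative_integral_circlepath(1)[OF *, of 0]
      by (simp add: contour_integrable_on)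
  qed
  have c: "?c x \<in> sphere 0 (1/2)" for x
    by (simp add: circlepath norm_mult)
  have vd: "norm (vector_derivative ?c (at x)) = pi" for x
    by (simp add: vector_derivative_circlepath norm_mult)
  have "(\<lambda>n. integral {0..1} (\<lambda>x. F n (?c x) / (?c x)\<^sup>2 * vector_derivative ?c (at x)))
        \<longlonglongrightarrow> integral {0..1} (\<lambda>x. h (?c x) / (?c x)\<^sup>2 * vector_derivative ?c (at x))"
  proof (rule dominated_convergence(2))
    show "(\<lambda>x. F n (?c x) / (?c x)\<^sup>2 * vector_derivative ?c (at x)) integrable_on {0..1}" for n
      by (rule int[OF F])
    show "(\<lambda>x::real. B * 4 * pi) integrable_on {0..1}"
      by (rule integrable_const_ivl)
    show "norm (F n (?c x) / (?c x)\<^sup>2 * vector_derivative ?c (at x)) \<le> B * 4 * pi" for n x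
    proof -
      have "norm ((?c x)\<^sup>2) = 1/4"
        using c[of x] unfolding norm_power by (simp only: mem_sphere_0) (simp add: power2_eq_square)
      then have "norm (F n (?c x) / (?c x)\<^sup>2 * vector_derivative ?c (at x)) = norm (F n (?c x)) * 4 * pi"
        by (simp only: norm_mult norm_divide vd) simp
      then show ?thesis
        using bnd[OF c] by simp
    qed
    show "(\<lambda>n. F n (?c x) / (?c x)\<^sup>2 * vector_derivative ?c (at x))
        \<longlonglongrightarrow> h (?c x) / (?c x)\<^sup>2 * vector_derivative ?c (at x)" for x
      using c[of x] by (intro tendsto_intros lim[OF c]) auto
  qed
  then show ?thesis
    unfolding eq[OF F] eq[OF h] by (rule tendsto_mult_left)
qed

lemma radial_loewner_pairD:
  assumes "radial_loewner_pair f W"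
  shows "\<And>t. t \<ge> 0 \<Longrightarrow> norm (W t) = 1" "\<And>z. z \<in> ball 0 1 \<Longrightarrow> f 0 z = z"
    "\<And>t z. t \<ge> 0 \<Longrightarrow> z \<in> ball 0 1 \<Longrightarrow> ((\<lambda>s. f s z) has_vector_derivative
           (- z * deriv (f t) z * ((W t + z) / (W t - z)))) (at t within {0..})"
    "\<And>t. t \<ge> 0 \<Longrightarrow> f t holomorphic_on ball 0 1" "\<And>t. t \<ge> 0 \<Longrightarrow> inj_on (f t) (ball 0 1)"
    "\<And>t. t \<ge> 0 \<Longrightarrow> f t ` ball 0 1 \<subseteq> ball 0 1"
    "\<And>t. t \<ge> 0 \<Longrightarrow> simply_connected (f t ` ball 0 1)"
  using assms unfolding radial_loewner_pair_def by (auto simp: image_subset_iff)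

text \<open>The right-hand side of the Loewner equation vanishes at the origin.\<close>

lemma loewner_map_zero:
  assumes f: "radial_loewner_pair f W" and "t \<ge> 0"
  shows "f t 0 = 0"
proof -
  note D = radial_loewner_pairD[OF f]
  have "((\<lambda>s. f s 0) has_derivative (\<lambda>h. 0)) (at s within {0..})" if "s \<in> {0..}" for s
    using D(3)[of s 0] that by (simp add: has_vector_derivative_def)
  then obtain c where "\<And>s. s \<in> {0..} \<Longrightarrow> f s 0 = c"
    using has_derivative_zero_constant[of "{0::real..}" "\<lambda>s. f s 0"] by auto
  then have "f t 0 = f 0 0"
    using assms(2) by simp
  then show ?thesis
    using D(2)[of 0] by simp
qed

text \<open>This bound makes \<open>f\<close> Lipschitz in time on the circle of radius \<open>1/2\<close>, which gives the domination
for differentiating Cauchy's formula in time.\<close>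

lemma loewner_field_bound:
  assumes f: "radial_loewner_pair f W" and "t \<ge> 0" and z: "z \<in> sphere 0 (1/2)"
  shows "norm (- z * deriv (f t) z * ((W t + z) / (W t - z))) \<le> 6"
proof -
  note D = radial_loewner_pairD[OF f]
  have z': "norm z = 1/2"
    using z by simp
  have "ball z (1/2) \<subseteq> ball 0 1"
  proof
    fix x assume "x \<in> ball z (1/2)"
    then show "x \<in> ball 0 1"
      using norm_triangle_ineq[of "x - z" z] z' by (simp add: dist_norm norm_minus_commute)
  qed
  moreover have "norm (f t x) \<le> 1" if "x \<in> ball 0 1" for x
    using D(6)[OF assms(2)] that by (force simp: image_subset_iff)
  ultimately have "norm (deriv (f t) z) \<le> 1 / (1/4)"
    by (intro norm_deriv_le_of_bounded[of "f t" z "1/2" 1 "1/4"] holomorphic_on_subset[OF D(4)[OF assms(2)]]) auto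
  then have 1: "norm (deriv (f t) z) \<le> 4"
    by simp
  have "norm (W t + z) \<le> 3/2"
    using norm_triangle_ineq[of "W t" z] D(1)[OF assms(2)] z' by simp
  moreover have "1/2 \<le> norm (W t - z)"
    using norm_triangle_ineq2[of "W t" z] D(1)[OF assms(2)] z' by simp
  ultimately have "norm (W t + z) / norm (W t - z) \<le> (3/2) / (1/2)"
    by (intro frac_le) auto
  then have "norm z * norm (deriv (f t) z) * (norm (W t + z) / norm (W t - z)) \<le> (1/2) * 4 * 3"
    using 1 z' by (intro mult_mono) auto
  then show ?thesis
    by (simp add: norm_mult norm_divide)
qed


lemma has_vector_derivative_iff_quotient_tendsto:
  fixes g :: "real \<Rightarrow> 'a::real_normed_vector"
  shows "(g has_vector_derivative d) (at t within S) \<longleftrightarrow>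
    ((\<lambda>s. (g s - g t) /\<^sub>R (s - t)) \<longlongrightarrow> d) (at t within S)"
proof -
  define A where "A = (\<lambda>s. (1 / norm (s - t)) *\<^sub>R (g s - (g t + (s - t) *\<^sub>R d)))"
  define B where "B = (\<lambda>s. (g s - g t) /\<^sub>R (s - t) - d)"
  have "norm (A s) = norm (B s)" if "s \<noteq> t" for s
  proof -
    have "B s = (1 / (s - t)) *\<^sub>R (g s - (g t + (s - t) *\<^sub>R d))"
      using that by (simp add: B_def scaleR_diff_right scaleR_add_right inverse_eq_divide)
    then show ?thesis
      by (simp add: A_def)
  qed
  then have "((\<lambda>s. norm (A s)) \<longlongrightarrow> 0) (at t within S) \<longleftrightarrow> ((\<lambda>s. norm (B s)) \<longlongrightarrow> 0) (at t within S)"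
    by (intro tendsto_cong) (auto simp: eventually_at_filter)
  then have "(A \<longlongrightarrow> 0) (at t within S) \<longleftrightarrow> (B \<longlongrightarrow> 0) (at t within S)"
    by (simp add: tendsto_norm_zero_iff)
  moreover have "(g has_vector_derivative d) (at t within S) \<longleftrightarrow> (A \<longlongrightarrow> 0) (at t within S)"
    unfolding has_vector_derivative_def has_derivative_within A_def
    by (simp add: bounded_linear_scaleR_left)
  ultimately show ?thesis
    unfolding B_def LIM_zero_iff by simp
qed

text \<open>This is the space derivative of the Loewner equation at \<open>0\<close>; the factor \<open>(W t + z) / (W t - z)\<close>
is \<open>1\<close> there.\<close>

lemma loewner_deriv_zero_has_derivative:
  assumes f: "radial_loewner_pair f W" and t: "t \<ge> 0"
  shows "((\<lambda>s. deriv (f s) 0) has_vector_derivative (- deriv (f t) 0)) (at t within {0..})"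
proof -
  note D = radial_loewner_pairD[OF f]
  define h where "h = (\<lambda>z. - z * deriv (f t) z * ((W t + z) / (W t - z)))"
  have Wz: "W t - z \<noteq> 0" if "z \<in> ball 0 1" for z
    using D(1)[OF t] that by auto
  have h: "h holomorphic_on ball 0 1"
    unfolding h_def using Wz
    by (intro holomorphic_intros holomorphic_deriv D(4) t) auto
  have "deriv h 0 = - deriv (f t) 0"
  proof -
    \<comment> \<open>\<open>h z = z * k z\<close>, so the derivative of \<open>h\<close> at \<open>0\<close> is \<open>k 0\<close>.\<close>
    define k where "k = (\<lambda>z. - deriv (f t) z * ((W t + z) / (W t - z)))"
    have "k holomorphic_on ball 0 1"
      unfolding k_def using Wz by (intro holomorphic_intros holomorphic_deriv D(4) t) auto
    then have "(k has_field_derivative deriv k 0) (at 0)"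
      by (intro holomorphic_derivI) auto
    then have "((\<lambda>z. z * k z) has_field_derivative (k 0)) (at 0)"
      by (auto intro!: derivative_eq_intros)
    moreover have "h = (\<lambda>z. z * k z)"
      by (auto simp: h_def k_def)
    moreover have "k 0 = - deriv (f t) 0"
      using Wz[of 0] by (simp add: k_def)
    ultimately show ?thesis
      by (simp add: DERIV_imp_deriv)
  qed
  have lip: "norm (f s z - f t z) \<le> 6 * \<bar>s - t\<bar>" if "s \<ge> 0" "z \<in> sphere 0 (1/2)" for s z
  proof -
    have "norm (f s z - f t z) \<le> 6 * norm (s - t)"
    proof (rule differentiable_bound[of "{0..}" "\<lambda>r. f r z"])
      fix x :: real assume x: "x \<in> {0..}"
      let ?d = "- z * deriv (f x) z * ((W x + z) / (W x - z))"
      show "((\<lambda>r. f r z) has_derivative (\<lambda>r. r *\<^sub>R ?d)) (at x within {0..})"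
        using D(3)[of x z] x that by (simp add: has_vector_derivative_def)
      have "norm ?d \<le> 6"
        using loewner_field_bound[OF f, of x z] x that by simp
      then show "onorm (\<lambda>r. r *\<^sub>R ?d) \<le> 6"
        by (intro onorm_bound)
          (simp_all only: norm_scaleR real_norm_def mult.commute[of 6] mult_left_mono abs_ge_zero)
    qed (use that t in auto)
    then show ?thesis by simp
  qed
  have "((\<lambda>s. (deriv (f s) 0 - deriv (f t) 0) /\<^sub>R (s - t)) \<longlongrightarrow> - deriv (f t) 0) (at t within {0..})"
    unfolding tendsto_at_iff_sequentially
  proof (intro allI impI)
    fix X :: "nat \<Rightarrow> real"
    assume X: "\<forall>i. X i \<in> {0..} - {t}" "X \<longlonglongrightarrow> t"
    define F where "F = (\<lambda>n z. (f (X n) z - f t z) /\<^sub>R (X n - t))"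
    have "(\<lambda>n. deriv (F n) 0) \<longlonglongrightarrow> deriv h 0"
    proof (rule deriv_tendsto_of_pointwise_bounded[OF _ h])
      show "F n holomorphic_on ball 0 1" for n
        unfolding F_def scaleR_conv_of_real using X t by (intro holomorphic_intros D(4)) auto
      show "(\<lambda>n. F n z) \<longlonglongrightarrow> h z" if "z \<in> sphere 0 (1/2)" for z
      proof -
        have "((\<lambda>s. (f s z - f t z) /\<^sub>R (s - t)) \<longlongrightarrow> h z) (at t within {0..})"
          using D(3)[OF t, of z] that
          unfolding has_vector_derivative_iff_quotient_tendsto h_def by simp
        then show ?thesis
          using X unfolding tendsto_at_iff_sequentially F_def comp_def by blast
      qed
      show "norm (F n z) \<le> 6" if "z \<in> sphere 0 (1/2)" for n z
      proof -
        have "X n \<noteq> t" "X n \<ge> 0"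
          using X by auto
        then show ?thesis
          using lip[of "X n" z] that
          by (simp add: F_def divide_simps mult.commute flip: divide_inverse_commute)
      qed
    qed
    moreover have "deriv (F n) 0 = (deriv (f (X n)) 0 - deriv (f t) 0) /\<^sub>R (X n - t)" for n
    proof -
      have "(f s has_field_derivative deriv (f s) 0) (at 0)" if "s \<ge> 0" for s
        by (intro holomorphic_derivI[OF D(4)]) (use that in auto)
      then show ?thesis
        unfolding F_def scaleR_conv_of_real using X t
        by (intro DERIV_imp_deriv) (auto intro!: derivative_eq_intros)
    qed
    ultimately show "((\<lambda>s. (deriv (f s) 0 - deriv (f t) 0) /\<^sub>R (s - t)) \<circ> X) \<longlonglongrightarrow> - deriv (f t) 0"
      using \<open>deriv h 0 = - deriv (f t) 0\<close> by (simp add: comp_def)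
  qed
  then show ?thesis
    unfolding has_vector_derivative_iff_quotient_tendsto .
qed

lemma loewner_deriv_zero:
  assumes f: "radial_loewner_pair f W" and t: "t \<ge> 0"
  shows "deriv (f t) 0 = exp (- of_real t)"
proof -
  note D = radial_loewner_pairD[OF f]
  have "((\<lambda>s. exp (of_real s) * deriv (f s) 0) has_vector_derivative 0) (at s within {0..})"
    if "s \<in> {0..}" for s :: real
  proof -
    have "((\<lambda>s. exp (complex_of_real s)) has_vector_derivative exp (of_real s)) (at s within {0..})"
      by (intro has_vector_derivative_real_field DERIV_exp)
    from has_vector_derivative_mult[OF this loewner_deriv_zero_has_derivative[OF f, of s]]
    show ?thesis using that by simp
  qed
  then obtain c where c: "\<And>s. s \<in> {0..} \<Longrightarrow> exp (of_real s) * deriv (f s) 0 = c"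
    using has_derivative_zero_constant[of "{0::real..}" "\<lambda>s. exp (of_real s) * deriv (f s) 0"]
    by (auto simp: has_vector_derivative_def)
  have "deriv (f 0) 0 = 1"
  proof -
    have "deriv (f 0) 0 = deriv (\<lambda>z. z) 0"
      using D(2) by (intro deriv_cong_ev eventually_nhds_in_open[THEN eventually_mono, of "ball 0 1"]) auto
    then show ?thesis by simp
  qed
  then have "exp (of_real t) * deriv (f t) 0 = 1"
    using c[of t] c[of 0] t by simp
  then show ?thesis
    by (simp add: exp_minus field_simps)
qed

text \<open>Cauchy's inequality for a square root \<open>q\<close> of \<open>f - w\<close>: \<open>q\<close> is bounded, \<open>|q 0|\<^sup>2 = |w|\<close> and
\<open>deriv f 0 = 2 q 0 deriv q 0\<close>.\<close>

lemma omitted_value_lower_bound: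
  assumes f: "f holomorphic_on ball 0 1" "f ` ball 0 1 \<subseteq> ball 0 1" "f 0 = 0"
    and w: "w \<notin> f ` ball 0 1" "norm w \<le> 1"
  shows "(norm (deriv f 0))\<^sup>2 \<le> 32 * norm w"
proof -
  have nz: "f z - w \<noteq> 0" if "z \<in> ball 0 1" for z
    using w that by auto
  have hol: "(\<lambda>z. f z - w) holomorphic_on ball 0 1"
    by (intro holomorphic_intros f)
  obtain q where q: "q holomorphic_on ball 0 1" "\<And>z. z \<in> ball 0 1 \<Longrightarrow> f z - w = (q z)\<^sup>2"
    using contractible_imp_holomorphic_sqrt[OF hol convex_imp_contractible[OF convex_ball] nz] by metis
  have "norm (q z) \<le> sqrt 2" if z: "z \<in> ball 0 1" for z
  proof -
    have "(norm (q z))\<^sup>2 = norm (f z - w)"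
      by (simp add: q(2)[OF z] norm_power)
    also have "\<dots> \<le> norm (f z) + norm w"
      by (rule norm_triangle_ineq4)
    also have "\<dots> \<le> 2"
      using f(2) z w(2) by (force simp: image_subset_iff)
    finally show ?thesis
      by (rule real_le_rsqrt)
  qed
  then have q': "norm (deriv q 0) \<le> sqrt 2 / (1/2)"
    by (intro norm_deriv_le_of_bounded[OF q(1)]) auto
  have "(q has_field_derivative deriv q 0) (at 0)"
    by (intro holomorphic_derivI[OF q(1)]) auto
  then have "((\<lambda>z. (q z)\<^sup>2 + w) has_field_derivative 2 * q 0 * deriv q 0) (at 0)"
    by (auto intro!: derivative_eq_intros)
  moreover have "deriv f 0 = deriv (\<lambda>z. (q z)\<^sup>2 + w) 0"
    using q(2) by (intro deriv_cong_ev eventually_nhds_in_open[THEN eventually_mono, of "ball 0 1"])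
      (auto simp: algebra_simps)
  ultimately have "norm (deriv f 0) = 2 * norm (q 0) * norm (deriv q 0)"
    by (simp add: DERIV_imp_deriv norm_mult)
  also have "\<dots> \<le> 2 * norm (q 0) * (sqrt 2 / (1/2))"
    using q' by (intro mult_left_mono) auto
  finally have "(norm (deriv f 0))\<^sup>2 \<le> (2 * norm (q 0) * (sqrt 2 / (1/2)))\<^sup>2"
    by (intro power_mono) auto
  also have "\<dots> = 32 * (norm (q 0))\<^sup>2"
    by (simp add: power_mult_distrib power2_eq_square)
  also have "(norm (q 0))\<^sup>2 = norm w"
    using q(2)[of 0] f(3) by (metis centre_in_ball diff_0 norm_minus_cancel norm_power zero_less_one)
  finally show ?thesis .
qed

lemma loewner_domain_inner_radius:
  assumes f: "radial_loewner_pair f W" and t: "0 \<le> t" "t \<le> T"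
    and w: "w \<notin> f t ` ball 0 1"
  shows "exp (- 2 * T) / 32 \<le> norm w"
proof (cases "norm w \<le> 1")
  case True
  note D = radial_loewner_pairD[OF f]
  have "(norm (deriv (f t) 0))\<^sup>2 \<le> 32 * norm w"
    using omitted_value_lower_bound[OF D(4)[OF t(1)] D(6)[OF t(1)] loewner_map_zero[OF f t(1)] w True] .
  moreover have "norm (deriv (f t) 0) = exp (- t)"
    by (simp add: loewner_deriv_zero[OF f t(1)] norm_exp_eq_Re)
  ultimately have "exp (- 2 * t) \<le> 32 * norm w"
    by (simp flip: exp_double)
  moreover have "exp (- 2 * T) \<le> exp (- 2 * t)"
    using t by simp
  ultimately show ?thesis by linarith
next
  case False
  moreover have "exp (- 2 * T) \<le> 1"
    using t by simp
  ultimately show ?thesis by linarith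
qed

section \<open>The crosscut and the curve\<close>

text \<open>Since \<open>closure A\<close> avoids \<open>K\<close>, the ends of \<open>A\<close> are on the unit circle and \<open>A\<close> is relatively closed
in the disc.  If \<open>p\<close> were outside the circle about \<open>z\<close>, then neither \<open>A\<close> nor \<open>K\<close> would separate
\<open>0\<close> from \<open>p\<close> in the disc, and hence neither would their disjoint union.\<close>

lemma crosscut_off_curve_encloses_tip:
  fixes K A :: "complex set"
  assumes K: "compact K" and G: "G = connected_component_set (ball 0 1 - K) 0"
    and A: "crosscut G A" "closure A \<inter> K = {}" "A \<subseteq> sphere z r"
    and far: "r < dist z 0" "r < dist z p" and p: "p \<in> G"
    and sep: "\<not> connected_component (G - A) 0 p"
  shows False
proof -
  define U where "U = ball 0 1 - K"
  have "open U"
    unfolding U_def using K by (intro open_Diff open_ball compact_imp_closed)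
  have GU: "G \<subseteq> U"
    unfolding G U_def by (rule connected_component_subset)
  obtain \<zeta> \<xi> where \<zeta>: "\<zeta> \<in> frontier G" "\<xi> \<in> frontier G" "closure A = A \<union> {\<zeta>, \<xi>}" and AG: "A \<subseteq> G"
    using A(1) unfolding crosscut_def by blast
  have fr: "x \<notin> ball 0 1" if "x \<in> frontier G" "x \<in> closure A" for x
  proof -
    have "x \<in> frontier U"
      using that(1) frontier_of_connected_component_subset[of U 0] unfolding G U_def by blast
    then have "x \<notin> U"
      using \<open>open U\<close> by (simp add: frontier_def interior_open)
    then show ?thesis
      using that(2) A(2) unfolding U_def by blast
  qed
  have "closure A \<subseteq> cball 0 1"
    using closure_mono[of A "ball 0 1"] AG GU unfolding U_def by auto
  then have \<zeta>1: "\<zeta> \<in> sphere 0 1"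
    using fr[OF \<zeta>(1)] \<zeta>(3) by auto
  have "closure A \<subseteq> sphere z r"
    using A(3) by (intro closure_minimal) auto
  then have \<zeta>r: "\<zeta> \<in> sphere z r"
    using \<zeta>(3) by blast
  have "closure A \<inter> ball 0 1 = A"
    using fr \<zeta> AG GU unfolding U_def by blast
  then have clA: "closedin (top_of_set (ball 0 1)) A"
    by (metis closed_closure closedin_closed_Int inf_commute)
  have clK: "closedin (top_of_set (ball 0 1)) (K \<inter> ball 0 1)"
    using K compact_imp_closed by (metis closedin_closed_Int inf_commute)
  have pB: "p \<in> ball 0 1"
    using p GU unfolding U_def by blast
  have "connected_component (ball 0 1 - A) 0 p"
  proof (rule connected_component_maximal[THEN subsetD, of _ "ball 0 1 - cball z r", simplified mem_Collect_eq])
    show "connected (ball 0 1 - cball z r)"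
      using connected_ball_Diff_cball[OF \<zeta>1 \<zeta>r] .
    show "ball 0 1 - cball z r \<subseteq> ball 0 1 - A"
      using A(3) by auto
  qed (use far pB in auto)
  moreover have "connected_component (ball 0 1 - K \<inter> ball 0 1) 0 p"
    using p unfolding G by (simp add: Diff_Int)
  moreover have "A \<inter> (K \<inter> ball 0 1) = {}"
    using A(2) closure_subset by blast
  ultimately have "connected_component (ball 0 1 - (A \<union> (K \<inter> ball 0 1))) 0 p"
    using disjoint_Un_separates_plane_domain[OF homeomorphic_ball01_UNIV clA clK] by blast
  then obtain T where T: "connected T" "T \<subseteq> ball 0 1 - (A \<union> (K \<inter> ball 0 1))" "0 \<in> T" "p \<in> T"
    unfolding connected_component_def by blast
  have "T \<subseteq> G"
    unfolding G using T by (intro connected_component_maximal) auto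
  then have "connected_component (G - A) 0 p"
    using T unfolding connected_component_def by blast
  then show False
    using sep by blast
qed

text \<open>The subpath starts at the last visit of the curve to \<open>closure C\<close>.\<close>

lemma dist_le_diameter_crosscut_subpath:
  assumes \<gamma>: "continuous_on {0..} \<gamma>" and t: "0 \<le> t" and hit: "\<gamma> ` {0..t} \<inter> closure C \<noteq> {}"
  obtains p where "p \<in> closure C" "dist (\<gamma> t) p \<le> diameter (crosscut_subpath \<gamma> t C)"
proof -
  define H where "H = {x \<in> {0..t}. \<gamma> x \<in> closure C}"
  have \<gamma>t: "continuous_on {0..t} \<gamma>"
    using \<gamma> by (rule continuous_on_subset) auto
  have "H \<noteq> {}"
    using hit by (auto simp: H_def)
  moreover have "compact H"
  proof -
    have "closed ({0..t} \<inter> \<gamma> -` closure C)"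
      by (intro continuous_closed_preimage \<gamma>t) auto
    moreover have "{0..t} \<inter> \<gamma> -` closure C = H"
      by (auto simp: H_def)
    moreover have "bounded H"
      by (rule bounded_subset[of "{0..t}"]) (auto simp: H_def)
    ultimately show ?thesis
      by (simp add: compact_eq_bounded_closed)
  qed
  ultimately obtain m where m: "m \<in> H" "\<And>x. x \<in> H \<Longrightarrow> x \<le> m"
    using compact_attains_sup[of H] by blast
  define S where "S = {s. 0 < s \<and> s \<le> t \<and> \<gamma> ` {t - s..t} \<inter> closure C \<noteq> {}}"
  define s0 where "s0 = crosscut_time \<gamma> t C"
  have s0: "s0 = (if S = {} then t else Inf S)"
    unfolding s0_def crosscut_time_def Let_def S_def by (rule refl)
  have "0 \<le> s0 \<and> s0 \<le> t \<and> t - s0 \<le> m"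
  proof (cases "S = {}")
    case True
    then show ?thesis
      using s0 t m(1) by (simp add: H_def)
  next
    case False
    have lower: "t - m \<le> s" if s: "s \<in> S" for s
    proof -
      obtain x where "x \<in> {t - s..t}" "\<gamma> x \<in> closure C" "s \<le> t"
        using s unfolding S_def by blast
      then show ?thesis
        using m(2)[of x] by (auto simp: H_def)
    qed
    have "bdd_below S"
      using lower by (auto simp: bdd_below_def)
    moreover obtain s where "s \<in> S"
      using False by blast
    ultimately have "Inf S \<le> t"
      by (intro cInf_lower2[of s]) (auto simp: S_def)
    moreover have "t - m \<le> Inf S"
      using False lower by (rule cInf_greatest)
    moreover have "0 \<le> Inf S"
      using False by (intro cInf_greatest) (auto simp: S_def)
    ultimately show ?thesis
      using False s0 by simp
  qed
  then have sub: "{t - s0..t} \<subseteq> {0..t}" "m \<in> {t - s0..t}" "t \<in> {t - s0..t}"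
    using m(1) by (auto simp: H_def)
  have "bounded (crosscut_subpath \<gamma> t C)"
    unfolding crosscut_subpath_def s0_def[symmetric]
    by (intro compact_imp_bounded compact_continuous_image continuous_on_subset[OF \<gamma>t sub(1)]) auto
  then have "dist (\<gamma> t) (\<gamma> m) \<le> diameter (crosscut_subpath \<gamma> t C)"
    using sub(2,3) unfolding crosscut_subpath_def s0_def[symmetric]
    by (intro diameter_bounded_bound) auto
  moreover have "\<gamma> m \<in> closure C"
    using m(1) by (simp add: H_def)
  ultimately show thesis
    using that by blast
qed

text \<open>If the curve hits \<open>closure A\<close>, the modulus \<open>\<eta>\<close> enters through the subpath since the last hit, and
the distance is at most \<open>\<eta> + r\<close>; if not, the tip is not outside the circle that contains \<open>A\<close>, and the
distance is at most \<open>r\<close>.  Here \<open>r\<close> is at most \<open>\<eta> / 2\<close>, as it is half of the argument \<open>300 * \<Delta>\<close>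
of the modulus.\<close>

lemma tip_estimate:
  assumes f: "radial_loewner_pair f W" and gen: "generated_by_curve f W \<gamma>"
    and t: "0 \<le> t" "t \<le> T" and d: "0 < d" "d \<le> 1"
    and small: "boundary_dist f W t d < exp (- 2 * T) / 4832"
  shows "ereal (dist (\<gamma> t) (radial_point f W t d))
    \<le> ereal 2 * tip_structure_modulus f W \<gamma> T (300 * boundary_dist f W t d)"
proof -
  note D = radial_loewner_pairD[OF f]
  \<comment> \<open>The rotation by \<open>W t\<close> places the path to the tip on the positive real axis.\<close>
  define F where "F = (\<lambda>\<zeta>. f t (\<zeta> * W t))"
  define G where "G = loewner_domain f t"
  define z where "z = radial_point f W t d"
  define \<Delta> where "\<Delta> = boundary_dist f W t d"
  define r where "r = 150 * \<Delta>"
  define \<eta> where "\<eta> = tip_structure_modulus f W \<gamma> T (300 * \<Delta>)"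
  have W1: "norm (W t) = 1" "W t \<noteq> 0"
    using D(1)[OF t(1)] by auto
  have rot: "(\<lambda>\<zeta>. \<zeta> * W t) ` ball 0 1 = ball 0 1"
  proof (intro equalityI subsetI)
    fix x assume "x \<in> ball (0::complex) 1"
    then show "x \<in> (\<lambda>\<zeta>. \<zeta> * W t) ` ball 0 1"
      using W1 by (intro image_eqI[of _ _ "x / W t"]) (auto simp: norm_divide)
  qed (use W1 in \<open>auto simp: norm_mult\<close>)
  have F: "F holomorphic_on ball 0 1" "inj_on F (ball 0 1)" "G = F ` ball 0 1"
  proof -
    have "(f t \<circ> (\<lambda>\<zeta>. \<zeta> * W t)) holomorphic_on ball 0 1"
      by (intro holomorphic_on_compose holomorphic_intros) (simp add: rot D(4)[OF t(1)])
    then show "F holomorphic_on ball 0 1"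
      by (simp add: F_def comp_def)
    have "inj_on (f t \<circ> (\<lambda>\<zeta>. \<zeta> * W t)) (ball 0 1)"
      using W1 D(5)[OF t(1)] by (intro comp_inj_on) (auto simp: rot inj_on_def)
    then show "inj_on F (ball 0 1)"
      by (simp add: F_def comp_def)
    have "F ` ball 0 1 = f t ` (\<lambda>\<zeta>. \<zeta> * W t) ` ball 0 1"
      by (auto simp: F_def)
    then show "G = F ` ball 0 1"
      by (simp add: rot G_def loewner_domain_def)
  qed
  have point: "radial_point f W t x = F (complex_of_real (1 - x))" for x
    by (simp add: radial_point_def F_def)
  have on_radius: "complex_of_real (1 - x) \<in> ball 0 1" if "0 < x" "x \<le> 1" for x
  proof -
    have "norm (complex_of_real (1 - x)) = 1 - x"
      unfolding norm_of_real using that by simp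
    then show ?thesis
      using that unfolding mem_ball_0 by linarith
  qed
  have F0: "F 0 = 0"
    using loewner_map_zero[OF f t(1)] by (simp add: F_def)
  have G: "bounded G" "simply_connected G" "open G"
  proof -
    show "bounded G" "simply_connected G"
      using D(6,7)[OF t(1)] bounded_subset[OF bounded_ball] by (auto simp: G_def loewner_domain_def)
    show "open G"
      unfolding F(3) using F by (intro open_mapping_thm3) auto
  qed
  have "z \<in> G"
    unfolding z_def point F(3) using d by (intro imageI on_radius) auto
  have \<Delta>: "\<Delta> = infdist z (frontier G)"
    by (simp add: \<Delta>_def boundary_dist_def z_def G_def)
  obtain w where w: "w \<notin> G" "dist z w = \<Delta>" "0 < \<Delta>"
    using nearest_frontier_point[OF G(3,1) \<open>z \<in> G\<close>] unfolding \<Delta> by metis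
  \<comment> \<open>Here \<open>4832 = 32 * 151\<close>, and \<open>|w| \<le> |z| + \<Delta>\<close> would be at most \<open>151 * \<Delta>\<close> if \<open>|z| \<le> r\<close>.\<close>
  have "exp (- 2 * T) / 32 \<le> norm w"
    using loewner_domain_inner_radius[OF f t] w(1) by (simp add: G_def loewner_domain_def)
  moreover have "norm w \<le> norm z + \<Delta>"
    using norm_triangle_sub[of w z] w(2) by (simp add: dist_norm norm_minus_commute)
  moreover have "\<Delta> < exp (- 2 * T) / 4832"
    using small by (simp add: \<Delta>_def)
  ultimately have "r < norm z"
    by (simp add: r_def)
  then have far0: "r < dist z 0"
    by simp
  obtain A where A: "A \<subseteq> sphere z r" "crosscut G A"
    and sep: "\<And>s::real. 1 - d < s \<Longrightarrow> s < 1 \<Longrightarrow> F s \<notin> A \<and> \<not> connected_component (G - A) 0 (F s)"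
    using short_crosscut_exists[OF F(1,2) F(3) G(1,2), of "1 - d" r] d far0
    unfolding F0 point[symmetric] z_def[symmetric] r_def \<Delta> by auto
  have cont: "continuous_on {0..} \<gamma>"
    using gen by (simp add: generated_by_curve_def)
  have "0 \<notin> A"
    using A(1) far0 by auto
  \<comment> \<open>Points beyond \<open>z\<close> on the radius are those with \<open>x < d\<close>.\<close>
  have ev: "\<forall>\<^sub>F x in at_right 0. radial_point f W t x \<in> G \<and> radial_point f W t x \<notin> A
      \<and> \<not> connected_component (G - A) 0 (radial_point f W t x)"
    unfolding eventually_at_right_field
  proof (intro exI[of _ d] conjI allI impI)
    fix x :: real assume x: "0 < x" "x < d"
    show "radial_point f W t x \<in> G"
      unfolding point F(3) using x d by (intro imageI on_radius) auto
    show "radial_point f W t x \<notin> A" "\<not> connected_component (G - A) 0 (radial_point f W t x)"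
      using sep[of "1 - x"] x unfolding point by auto
  qed (use d in auto)
  have "A \<in> tip_crosscuts f W t (300 * \<Delta>)"
  proof -
    have "diameter A \<le> diameter (cball z r)"
      using A(1) by (intro diameter_subset) auto
    then have "diameter A \<le> 300 * \<Delta>"
      using w(3) by (simp add: r_def)
    moreover have "separates_tip f W t A"
      unfolding separates_tip_def G_def[symmetric] using \<open>0 \<notin> A\<close> ev
      by (auto elim: eventually_mono)
    ultimately show ?thesis
      using A(2) by (simp add: tip_crosscuts_def G_def)
  qed
  then have "ereal (diameter (crosscut_subpath \<gamma> t A)) \<le> \<eta>"
    unfolding \<eta>_def tip_structure_modulus_def using t
    by (intro max.coboundedI2 SUP_upper2[of t] SUP_upper2[of A]) auto
  moreover have "ereal (300 * \<Delta>) \<le> \<eta>"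
    by (simp add: \<eta>_def tip_structure_modulus_def)
  moreover have "dist (\<gamma> t) z \<le> diameter (crosscut_subpath \<gamma> t A) + r \<or> dist (\<gamma> t) z \<le> r"
  proof (cases "\<gamma> ` {0..t} \<inter> closure A = {}")
    case False
    obtain p where p: "p \<in> closure A" "dist (\<gamma> t) p \<le> diameter (crosscut_subpath \<gamma> t A)"
      using dist_le_diameter_crosscut_subpath[OF cont t(1) False] .
    have "closure A \<subseteq> sphere z r"
      using A(1) by (intro closure_minimal) auto
    then have "dist z p = r"
      using p(1) by auto
    then show ?thesis
      using p(2) dist_triangle2[of "\<gamma> t" z p] by simp
  next
    case True
    \<comment> \<open>Otherwise a point of the radius close to the tip is outside the circle as well.\<close>
    have "\<not> r < dist z (\<gamma> t)"
    proof
      assume "r < dist z (\<gamma> t)"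
      moreover have "((\<lambda>x. dist z (radial_point f W t x)) \<longlongrightarrow> dist z (\<gamma> t)) (at_right 0)"
        using gen t(1) by (intro tendsto_intros) (simp add: generated_by_curve_def)
      ultimately have "\<forall>\<^sub>F x in at_right 0. r < dist z (radial_point f W t x)"
        using order_tendstoD(1) by blast
      with ev have "\<forall>\<^sub>F x in at_right (0::real). \<exists>p. p \<in> G \<and> r < dist z p \<and> \<not> connected_component (G - A) 0 p"
        by eventually_elim blast
      then have "\<exists>x::real. \<exists>p. p \<in> G \<and> r < dist z p \<and> \<not> connected_component (G - A) 0 p"
        by (rule eventually_happens'[rotated]) simp
      then obtain p where p: "p \<in> G" "r < dist z p" "\<not> connected_component (G - A) 0 p"
        by blast
      have "compact (\<gamma> ` {0..t})"
      proof (rule compact_continuous_image)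
        show "continuous_on {0..t} \<gamma>"
          by (rule continuous_on_subset[OF cont]) auto
      qed simp
      moreover have "G = connected_component_set (ball 0 1 - \<gamma> ` {0..t}) 0"
        using gen t(1) by (simp add: generated_by_curve_def G_def)
      ultimately show False
        using crosscut_off_curve_encloses_tip[of "\<gamma> ` {0..t}" G A z r p] A True far0 p
        by (simp add: Int_commute)
    qed
    then show ?thesis
      by (simp add: dist_commute)
  qed
  ultimately have "ereal (dist (\<gamma> t) z) \<le> 2 * \<eta>"
    using w(3) by (cases \<eta>) (auto simp: r_def)
  then show ?thesis
    by (simp add: z_def \<eta>_def \<Delta>_def)
qed

theorem proposition3p2:
  "\<exists>c2 c3 :: real. 0 < c2 \<and> 0 < c3 \<and>
     (\<forall>T\<ge>0. \<exists>c1 :: real. 0 < c1 \<and>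
        (\<forall>f W \<gamma>. radial_loewner_pair f W \<longrightarrow> generated_by_curve f W \<gamma> \<longrightarrow>
           (\<forall>t\<in>{0..T}. \<forall>d\<in>{0<..1}. boundary_dist f W t d < c1 \<longrightarrow>
              ereal (dist (\<gamma> t) (radial_point f W t d))
                \<le> ereal c2 * tip_structure_modulus f W \<gamma> T (c3 * boundary_dist f W t d))))"
proof (rule exI[of _ 2], rule exI[of _ 300], intro conjI allI impI)
  fix T :: real
  show "\<exists>c1 :: real. 0 < c1 \<and>
        (\<forall>f W \<gamma>. radial_loewner_pair f W \<longrightarrow> generated_by_curve f W \<gamma> \<longrightarrow>
           (\<forall>t\<in>{0..T}. \<forall>d\<in>{0<..1}. boundary_dist f W t d < c1 \<longrightarrow>
              ereal (dist (\<gamma> t) (radial_point f W t d))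
                \<le> ereal 2 * tip_structure_modulus f W \<gamma> T (300 * boundary_dist f W t d)))"
    using tip_estimate by (intro exI[of _ "exp (- 2 * T) / 4832"]) auto
qed auto

end
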